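(* Fix $p_0\in\mathbb{R}$, $\alpha\in(0,1)$, and suppose that the sequences of estimators $\hat a^{(n)}$ and $\hat b^{(n)}$ satisfy Assumption A (stated in the context). Let $Q^{(n)}:=Q^{(n)\mathrm{eff}}_{p_0}(\hat a^{(n)},\hat b^{(n)})$, where $Q^{(n)\mathrm{eff}}_{p_0}(a,b)=\Delta^{(n)\mathrm{eff}}_p(p_0,a,b)/\sqrt{\Gamma^{\mathrm{eff}}_{p,p}(p_0,a,b)}$. Let $a,b>0$ and let $\tau_1^{(n)}$ be a bounded real sequence with limit $\tau_1$. Then, under the sequence of local alternatives $\mathrm{P}^{(n)}_{p_0+n^{-1/2}\tau_1^{(n)},a,b}$, as $n\to\infty$: (1) the two-sided test of $p=p_0$ against $p\ne p_0$, which rejects when $|Q^{(n)}|>z_{\alpha/2}$, has asymptotic power $$1-\Phi\left(z_{\alpha/2}-\tau_1\sqrt{\Gamma^{\mathrm{eff}}_{p,p}(p_0,a,b)}\right)+\Phi\left(-z_{\alpha/2}-\tau_1\sqrt{\Gamma^{\mathrm{eff}}_{p,p}(p_0,a,b)}\right);$$ (2) the one-sided test against $p>p_0$, which rejects when $Q^{(n)}>z_\alpha$, has asymptotic power $1-\Phi\left(z_\alpha-\tau_1\sqrt{\Gamma^{\mathrm{eff}}_{p,p}(p_0,a,b)}\right)$; (3) the one-sided test against $p<p_0$, which rejects when $Q^{(n)}<-z_\alpha$, has asymptotic power $\Phi\left(-z_\alpha-\tau_1\sqrt{\Gamma^{\mathrm{eff}}_{p,p}(p_0,a,b)}\right)$.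 Here asymptotic power means the limit of the rejection probability.
   Context: $\Phi$ is the standard normal cumulative distribution function and $z_\beta$ its upper $\beta$-quantile, $\Phi(z_\beta)=1-\beta$. GIG model. $\mathrm{GIG}(p,a,b)$ ($p\in\mathbb{R}$, $a,b>0$) has density $\frac{(a/b)^{p/2}}{2K_p(\sqrt{ab})}x^{p-1}e^{-(ax+b/x)/2}$, $x>0$, where $K_p(z)=\frac12\int_0^\infty t^{p-1}e^{-z(t+1/t)/2}dt$ is the modified Bessel function of the third kind. $\mathrm{P}^{(n)}_{p,a,b}$ is the joint law of $n$ i.i.d. $\mathrm{GIG}(p,a,b)$ observations $X_1,\dots,X_n$. Write $\vartheta=(p,a,b)'$; partial derivatives below are those of $(p,a,b)\mapsto\log K_p(\sqrt{ab})$. Central sequence: $\Delta^{(n)}_p(\vartheta)=n^{-1/2}\sum_{i=1}^n\left(\frac12\log(a/b)-\partial_p\log K_p(\sqrt{ab})+\log X_i\right)$, $\Delta^{(n)}_a(\vartheta)=n^{-1/2}\sum_{i=1}^n\left(\frac p{2a}-\partial_a\log K_p(\sqrt{ab})-\frac{X_i}2\right)$, $\Delta^{(n)}_b(\vartheta)=n^{-1/2}\sum_{i=1}^n\left(-\frac p{2b}-\partial_b\log K_p(\sqrt{ab})-\frac1{2X_i}\right)$. Fisher information matrix $\Gamma(\vartheta)$ (symmetric, rows and columns indexed by $p,a,b$): $\Gamma_{p,p}=\partial^2_{pp}\log K_p(\sqrt{ab})$, $\Gamma_{a,a}=\frac p{2a^2}+\partial^2_{aa}\log K_p(\sqrt{ab})$,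 $\Gamma_{b,b}=-\frac p{2b^2}+\partial^2_{bb}\log K_p(\sqrt{ab})$, $\Gamma_{p,a}=-\frac1{2a}+\partial^2_{ap}\log K_p(\sqrt{ab})$, $\Gamma_{p,b}=\frac1{2b}+\partial^2_{bp}\log K_p(\sqrt{ab})$, $\Gamma_{a,b}=\partial^2_{ab}\log K_p(\sqrt{ab})$. Efficient central sequence and information for $p$ (all $\Gamma$'s and $\Delta$'s evaluated at $\vartheta$): $$\Delta^{(n)\mathrm{eff}}_p(\vartheta)=\Delta^{(n)}_p-\frac{(\Gamma_{p,a},\Gamma_{p,b})\begin{pmatrix}\Gamma_{b,b}&-\Gamma_{a,b}\\-\Gamma_{a,b}&\Gamma_{a,a}\end{pmatrix}(\Delta^{(n)}_a,\Delta^{(n)}_b)'}{\Gamma_{a,a}\Gamma_{b,b}-\Gamma_{a,b}^2},\qquad \Gamma^{\mathrm{eff}}_{p,p}(\vartheta)=\frac{\det\Gamma(\vartheta)}{\Gamma_{a,a}\Gamma_{b,b}-\Gamma_{a,b}^2}.$$ Assumption A. The sequences of $(0,\infty)$-valued estimators $\hat a^{(n)},\hat b^{(n)}$ (measurable functions of $X_1,\dots,X_n$) are (i) root-$n$ consistent: for all $a,b>0$, $n^{1/2}(\hat a^{(n)}-a)=O_{\mathrm P}(1)$ and $n^{1/2}(\hat b^{(n)}-b)=O_{\mathrm P}(1)$ as $n\to\infty$ under $\mathrm{P}^{(n)}_{p_0,a,b}$; and (ii) locally asymptotically discrete: for all $a,b>0$ and all $c>0$ there exists $M=M(c)>0$ such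 that the number of possible values of $\hat a^{(n)}$ in $\{t\in\mathbb{R}:n^{1/2}|t-a|\le c\}$ and of $\hat b^{(n)}$ in $\{t\in\mathbb{R}:n^{1/2}|t-b|\le c\}$ is bounded by $M$, uniformly as $n\to\infty$. *)

theory Defs
  imports "HOL-Probability.Probability"
begin

definition Phi :: "real \<Rightarrow> real" where
  "Phi = cdf std_normal_distribution"

text \<open>Meant for \<open>0 < \<beta> < 1\<close>, where the defining equation has exactly one solution.\<close>

definition upper_quantile :: "real \<Rightarrow> real" where
  "upper_quantile \<beta> = (THE z. Phi z = 1 - \<beta>)"

definition besselK :: "real \<Rightarrow> real \<Rightarrow> real" where
  "besselK p z = (1/2) * (LBINT t:{0<..}. t powr (p - 1) * exp (- z * (t + 1/t) / 2))"

definition gig_density :: "real \<Rightarrow> real \<Rightarrow> real \<Rightarrow> real \<Rightarrow> real" where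
  "gig_density p a b x =
     (a / b) powr (p / 2) / (2 * besselK p (sqrt (a * b)))
       * x powr (p - 1) * exp (- (a * x + b / x) / 2)"

text \<open>The sample space is the open half-line itself, so that the space of the product measure
  below is exactly the set of positive samples of size \<open>n\<close>.\<close>

definition gig :: "real \<Rightarrow> real \<Rightarrow> real \<Rightarrow> real measure" where
  "gig p a b = density (restrict_space lborel {0<..}) (\<lambda>x. ennreal (gig_density p a b x))"

text \<open>A sample \<open>X\<^sub>1, \<dots>, X\<^sub>n\<close> is indexed from \<open>0\<close>: its entries are \<open>x 0, \<dots>, x (n - 1)\<close>.\<close>

definition sample_law :: "nat \<Rightarrow> real \<Rightarrow> real \<Rightarrow> real \<Rightarrow> (nat \<Rightarrow> real) measure" where
  "sample_law n p a b = (\<Pi>\<^sub>M i\<in>{..<n}. gig p a b)"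

definition logK :: "real \<Rightarrow> real \<Rightarrow> real \<Rightarrow> real" where
  "logK p a b = ln (besselK p (sqrt (a * b)))"

definition logK_p :: "real \<Rightarrow> real \<Rightarrow> real \<Rightarrow> real" where
  "logK_p p a b = deriv (\<lambda>p'. logK p' a b) p"
definition logK_a :: "real \<Rightarrow> real \<Rightarrow> real \<Rightarrow> real" where
  "logK_a p a b = deriv (\<lambda>a'. logK p a' b) a"
definition logK_b :: "real \<Rightarrow> real \<Rightarrow> real \<Rightarrow> real" where
  "logK_b p a b = deriv (\<lambda>b'. logK p a b') b"

definition Delta_p :: "nat \<Rightarrow> (nat \<Rightarrow> real) \<Rightarrow> real \<Rightarrow> real \<Rightarrow> real \<Rightarrow> real" where
  "Delta_p n x p a b =
     (\<Sum>i<n. ln (a / b) / 2 - logK_p p a b + ln (x i)) / sqrt (real n)"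
definition Delta_a :: "nat \<Rightarrow> (nat \<Rightarrow> real) \<Rightarrow> real \<Rightarrow> real \<Rightarrow> real \<Rightarrow> real" where
  "Delta_a n x p a b =
     (\<Sum>i<n. p / (2 * a) - logK_a p a b - x i / 2) / sqrt (real n)"
definition Delta_b :: "nat \<Rightarrow> (nat \<Rightarrow> real) \<Rightarrow> real \<Rightarrow> real \<Rightarrow> real \<Rightarrow> real" where
  "Delta_b n x p a b =
     (\<Sum>i<n. - p / (2 * b) - logK_b p a b - 1 / (2 * x i)) / sqrt (real n)"

definition Gamma_pp :: "real \<Rightarrow> real \<Rightarrow> real \<Rightarrow> real" where
  "Gamma_pp p a b = deriv (\<lambda>p'. logK_p p' a b) p"
definition Gamma_aa :: "real \<Rightarrow> real \<Rightarrow> real \<Rightarrow> real" where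
  "Gamma_aa p a b = p / (2 * a\<^sup>2) + deriv (\<lambda>a'. logK_a p a' b) a"
definition Gamma_bb :: "real \<Rightarrow> real \<Rightarrow> real \<Rightarrow> real" where
  "Gamma_bb p a b = - p / (2 * b\<^sup>2) + deriv (\<lambda>b'. logK_b p a b') b"
definition Gamma_pa :: "real \<Rightarrow> real \<Rightarrow> real \<Rightarrow> real" where
  "Gamma_pa p a b = - 1 / (2 * a) + deriv (\<lambda>a'. logK_p p a' b) a"
definition Gamma_pb :: "real \<Rightarrow> real \<Rightarrow> real \<Rightarrow> real" where
  "Gamma_pb p a b = 1 / (2 * b) + deriv (\<lambda>b'. logK_p p a b') b"
definition Gamma_ab :: "real \<Rightarrow> real \<Rightarrow> real \<Rightarrow> real" where
  "Gamma_ab p a b = deriv (\<lambda>a'. logK_b p a' b) a"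

definition fisher_information :: "real \<Rightarrow> real \<Rightarrow> real \<Rightarrow> real^3^3" where
  "fisher_information p a b =
     vector [vector [Gamma_pp p a b, Gamma_pa p a b, Gamma_pb p a b],
             vector [Gamma_pa p a b, Gamma_aa p a b, Gamma_ab p a b],
             vector [Gamma_pb p a b, Gamma_ab p a b, Gamma_bb p a b]]"

definition Delta_eff :: "nat \<Rightarrow> (nat \<Rightarrow> real) \<Rightarrow> real \<Rightarrow> real \<Rightarrow> real \<Rightarrow> real" where
  "Delta_eff n x p a b =
     Delta_p n x p a b
     - (vector [Gamma_pa p a b, Gamma_pb p a b] :: real^2)
         \<bullet> ((vector [vector [Gamma_bb p a b, - Gamma_ab p a b],
                      vector [- Gamma_ab p a b, Gamma_aa p a b]] :: real^2^2)
              *v vector [Delta_a n x p a b, Delta_b n x p a b])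
       / (Gamma_aa p a b * Gamma_bb p a b - (Gamma_ab p a b)\<^sup>2)"

definition Gamma_eff :: "real \<Rightarrow> real \<Rightarrow> real \<Rightarrow> real" where
  "Gamma_eff p a b =
     det (fisher_information p a b) / (Gamma_aa p a b * Gamma_bb p a b - (Gamma_ab p a b)\<^sup>2)"

definition Q_eff :: "nat \<Rightarrow> (nat \<Rightarrow> real) \<Rightarrow> real \<Rightarrow> real \<Rightarrow> real \<Rightarrow> real" where
  "Q_eff n x p a b = Delta_eff n x p a b / sqrt (Gamma_eff p a b)"

definition positive_samples :: "nat \<Rightarrow> (nat \<Rightarrow> real) measure" where
  "positive_samples n = (\<Pi>\<^sub>M i\<in>{..<n}. restrict_space borel {0<..})"

definition positive_estimators :: "(nat \<Rightarrow> (nat \<Rightarrow> real) \<Rightarrow> real) \<Rightarrow> bool" where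
  "positive_estimators T \<longleftrightarrow>
     (\<forall>n\<ge>1. T n \<in> borel_measurable (positive_samples n) \<and>
             (\<forall>x\<in>space (positive_samples n). T n x > 0))"

text \<open>\<open>Y n = O\<^sub>P(1)\<close> as \<open>n\<close> tends to infinity, where \<open>Y n\<close> is a random variable on \<open>M n\<close>.\<close>

definition bounded_in_prob :: "(nat \<Rightarrow> 'a measure) \<Rightarrow> (nat \<Rightarrow> 'a \<Rightarrow> real) \<Rightarrow> bool" where
  "bounded_in_prob M Y \<longleftrightarrow>
     (\<forall>\<epsilon>>0. \<exists>C. \<forall>\<^sub>F n in sequentially. \<P>(x in M n. \<bar>Y n x\<bar> > C) \<le> \<epsilon>)"

text \<open>The possible values of \<open>T n\<close> are its values on all positive samples of size \<open>n\<close>.\<close>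

definition locally_discrete_at :: "(nat \<Rightarrow> (nat \<Rightarrow> real) \<Rightarrow> real) \<Rightarrow> real \<Rightarrow> bool" where
  "locally_discrete_at T t0 \<longleftrightarrow>
     (\<forall>c>0. \<exists>m::nat. m > 0 \<and>
        (\<forall>\<^sub>F n in sequentially.
           let V = T n ` space (positive_samples n) \<inter> {t. sqrt (real n) * \<bar>t - t0\<bar> \<le> c}
           in finite V \<and> card V \<le> m))"

definition assumption_A ::
  "real \<Rightarrow> (nat \<Rightarrow> (nat \<Rightarrow> real) \<Rightarrow> real) \<Rightarrow> (nat \<Rightarrow> (nat \<Rightarrow> real) \<Rightarrow> real) \<Rightarrow> bool" where
  "assumption_A p0 ahat bhat \<longleftrightarrow>
     positive_estimators ahat \<and> positive_estimators bhat \<and>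
     (\<forall>a>0. \<forall>b>0.
        bounded_in_prob (\<lambda>n. sample_law n p0 a b) (\<lambda>n x. sqrt (real n) * (ahat n x - a)) \<and>
        bounded_in_prob (\<lambda>n. sample_law n p0 a b) (\<lambda>n x. sqrt (real n) * (bhat n x - b))) \<and>
     (\<forall>a>0. \<forall>b>0. locally_discrete_at ahat a \<and> locally_discrete_at bhat b)"

end

theory Submission
  imports Defs
begin

text \<open>The GIG laws form an exponential family with sufficient statistic
  \<open>T x = (ln x, - x / 2, - 1 / (2 x))\<close> and log-normalizer
  \<open>log K\<^sub>p(\<surd>(a b)) + (p / 2) ln (b / a) + ln 2\<close>. Hence the central sequence is the centred sum of
  \<open>T\<close> and the information matrix is the covariance matrix of \<open>T\<close>, positive definite because \<open>ln x\<close>,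
  \<open>x\<close>, \<open>1 / x\<close> and \<open>1\<close> are linearly independent. The second moment of the likelihood ratio between
  \<open>p\<^sub>0 + \<tau> / \<surd>n\<close> and \<open>p\<^sub>0\<close> stays bounded, so the local alternatives are contiguous to the null. Under
  the null, plugging root-n consistent estimators into the studentized efficient central sequence
  changes it by \<open>o\<^sub>P(1)\<close>: the centred sums depend on \<open>(a, b)\<close> only through the means of \<open>T\<close>, and the
  efficient score is uncorrelated with the other two statistics, which cancels the linear term.
  Under the alternatives the studentized sequence at the true \<open>(a, b)\<close> obeys the central limit
  theorem for row-wise i.i.d. arrays, with mean tending to \<open>\<tau>\<^sub>1\<surd>\<Gamma>\<close>, where \<open>\<Gamma>\<close> is the efficient
  information.\<close>

section \<open>The exponential family\<close>

text \<open>Two difficulties shape the proof. The central sequence and the information are given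
  through \<open>deriv\<close> of a Bessel function; the substitution x = sqrt (b / a) * t turns
  that function into the unnormalised integral of exp (\<theta> \<bullet> T) against dx / x, so that
  every derivative becomes a moment of T. The second difficulty is that root-n consistency is
  assumed at \<open>p0\<close> only, while the power is a limit under moving alternatives. Hence the
  effect of estimating a and b is bounded at \<open>p0\<close>, and only the probabilities of the
  resulting small events are carried over by contiguity; the limit law is found directly under the
  alternatives. Randomness of the estimators is removed by a deterministic statement: the plug-in
  error is a function of three centred sums and two rescaled estimation errors, uniformly small on
  every bounded box. The shift of the limit law has a geometric origin: the p-derivative of the mean
  of the efficient score is its covariance with ln, and orthogonality to the other two statistics
  makes that covariance equal to its variance.\<close>

abbreviation half_line :: "real measure" where
  "half_line \<equiv> restrict_space lborel {0<..}"

section \<open>Exponential weights on the half-line and functions of moderate growth at both of its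
  ends\<close>

definition gig_stat :: "real \<Rightarrow> real \<times> real \<times> real" where
  "gig_stat x = (ln x, - x / 2, - 1 / (2 * x))"

text \<open>The factor 1 / x is the density of the scale-invariant measure dx / x. Relative to it
  the weight x powr (p - 1) becomes exp (p * ln x), so the exponent is linear in (p, a, b).\<close>

definition gig_int :: "(real \<Rightarrow> real) \<Rightarrow> real \<times> real \<times> real \<Rightarrow> real" where
  "gig_int f \<theta> = (\<integral>x. f x * exp (\<theta> \<bullet> gig_stat x) / x \<partial>half_line)"

definition gig_params :: "(real \<times> real \<times> real) set" where
  "gig_params = UNIV \<times> {0<..} \<times> {0<..}"

text \<open>Growth is measured by powers of x + 1 / x, which controls 0 and infinity at once. The
  class is closed under sums and products, contains ln, x, 1 / x and all real powers of x, and every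
  member is integrable against every weight of the family; this settles all integrability questions
  below.\<close>

definition tame :: "(real \<Rightarrow> real) \<Rightarrow> bool" where
  "tame f \<longleftrightarrow> f \<in> borel_measurable borel \<and> (\<exists>C k. \<forall>x>0. \<bar>f x\<bar> \<le> C * (x + 1 / x) ^ k)"

lemma add_inverse_ge_2:
  fixes x :: real
  assumes "x > 0"
  shows "x + 1 / x \<ge> 2"
proof -
  have "(x - 1)\<^sup>2 / x \<ge> 0" using assms by simp
  also have "(x - 1)\<^sup>2 / x = x + 1 / x - 2"
    using assms by (simp add: field_simps power2_eq_square)
  finally show ?thesis by simp
qed

lemma abs_ln_le_add_inverse:
  fixes x :: real
  assumes "x > 0"
  shows "exp \<bar>ln x\<bar> \<le> x + 1 / x" and "\<bar>ln x\<bar> \<le> x + 1 / x"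
proof -
  show "exp \<bar>ln x\<bar> \<le> x + 1 / x"
    using assms by (auto simp: abs_if exp_minus inverse_eq_divide)
  then show "\<bar>ln x\<bar> \<le> x + 1 / x"
    using exp_ge_add_one_self[of "\<bar>ln x\<bar>"] by linarith
qed

text \<open>Since exp |ln x| is the larger of x and 1 / x, every real power of x is at most a power
  of x + 1 / x; the exponent is rounded up to a natural number to fit \<open>tame\<close>.\<close>

lemma exp_mult_ln_le:
  fixes x :: real
  assumes "x > 0"
  shows "exp (p * ln x) \<le> (x + 1 / x) ^ nat \<lceil>\<bar>p\<bar>\<rceil>"
proof -
  define N where "N = nat \<lceil>\<bar>p\<bar>\<rceil>"
  have N: "\<bar>p\<bar> \<le> real N" unfolding N_def by linarith
  have "exp (p * ln x) \<le> exp (real N * \<bar>ln x\<bar>)"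
    using N mult_mono[of "\<bar>p\<bar>" "real N" "\<bar>ln x\<bar>" "\<bar>ln x\<bar>"]
    by (simp add: abs_mult[symmetric])
  also have "\<dots> = exp \<bar>ln x\<bar> ^ N" by (simp add: exp_of_nat_mult)
  also have "\<dots> \<le> (x + 1 / x) ^ N"
    using abs_ln_le_add_inverse(1)[OF assms] by (intro power_mono) auto
  finally show ?thesis by (simp add: N_def)
qed

lemma tame_measurable [measurable_dest]: "tame f \<Longrightarrow> f \<in> borel_measurable borel"
  by (simp add: tame_def)

lemma tame_bound:
  assumes "tame f"
  obtains C k where "C \<ge> 0" "\<And>x. x > 0 \<Longrightarrow> \<bar>f x\<bar> \<le> C * (x + 1 / x) ^ k"
proof -
  obtain C k where C: "\<forall>x>0. \<bar>f x\<bar> \<le> C * (x + 1 / x) ^ k" using assms by (auto simp: tame_def)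
  have "\<bar>f x\<bar> \<le> max C 0 * (x + 1 / x) ^ k" if "x > 0" for x
    using C[rule_format, OF that] mult_right_mono[of C "max C 0" "(x + 1 / x) ^ k"] that
    by (auto intro: order_trans)
  then show ?thesis using that[of "max C 0" k] by auto
qed

lemma tame_add [simp, intro]:
  assumes "tame f" "tame g"
  shows "tame (\<lambda>x. f x + g x)"
proof -
  obtain C k where C: "C \<ge> 0" "\<And>x. x > 0 \<Longrightarrow> \<bar>f x\<bar> \<le> C * (x + 1 / x) ^ k"
    using tame_bound[OF assms(1)] by blast
  obtain D l where D: "D \<ge> 0" "\<And>x. x > 0 \<Longrightarrow> \<bar>g x\<bar> \<le> D * (x + 1 / x) ^ l"
    using tame_bound[OF assms(2)] by blast
  have "\<bar>f x + g x\<bar> \<le> (C + D) * (x + 1 / x) ^ (k + l)" if x: "x > 0" for x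
  proof -
    have "(x + 1 / x) ^ k \<le> (x + 1 / x) ^ (k + l)" "(x + 1 / x) ^ l \<le> (x + 1 / x) ^ (k + l)"
      using add_inverse_ge_2[OF x] by (auto intro!: power_increasing)
    then have "C * (x + 1 / x) ^ k + D * (x + 1 / x) ^ l \<le> (C + D) * (x + 1 / x) ^ (k + l)"
      using C(1) D(1) by (auto simp: distrib_right intro!: add_mono mult_left_mono)
    then show ?thesis using C(2)[OF x] D(2)[OF x] by linarith
  qed
  moreover have "(\<lambda>x. f x + g x) \<in> borel_measurable borel"
    using assms[THEN tame_measurable] by measurable
  ultimately show ?thesis unfolding tame_def by blast
qed

lemma tame_mult [simp, intro]:
  assumes "tame f" "tame g"
  shows "tame (\<lambda>x. f x * g x)"
proof -
  obtain C k where C: "C \<ge> 0" "\<And>x. x > 0 \<Longrightarrow> \<bar>f x\<bar> \<le> C * (x + 1 / x) ^ k"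
    using tame_bound[OF assms(1)] by blast
  obtain D l where D: "D \<ge> 0" "\<And>x. x > 0 \<Longrightarrow> \<bar>g x\<bar> \<le> D * (x + 1 / x) ^ l"
    using tame_bound[OF assms(2)] by blast
  have "\<bar>f x * g x\<bar> \<le> (C * D) * (x + 1 / x) ^ (k + l)" if x: "x > 0" for x
  proof -
    have "\<bar>f x\<bar> * \<bar>g x\<bar> \<le> (C * (x + 1 / x) ^ k) * (D * (x + 1 / x) ^ l)"
      using C D x by (intro mult_mono) auto
    then show ?thesis by (simp add: abs_mult power_add mult_ac)
  qed
  moreover have "(\<lambda>x. f x * g x) \<in> borel_measurable borel"
    using assms[THEN tame_measurable] by measurable
  ultimately show ?thesis unfolding tame_def by blast
qed

lemma tame_const [simp, intro]: "tame (\<lambda>x. c)"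
  unfolding tame_def by (intro conjI exI[of _ "\<bar>c\<bar>"] exI[of _ "0 :: nat"]) auto

lemma tame_uminus [simp, intro]: "tame f \<Longrightarrow> tame (\<lambda>x. - f x)"
  using tame_mult[OF tame_const[of "-1"]] by simp

lemma tame_diff [simp, intro]: "tame f \<Longrightarrow> tame g \<Longrightarrow> tame (\<lambda>x. f x - g x)"
  using tame_add[OF _ tame_uminus] by simp

lemma tame_cmult [simp, intro]: "tame f \<Longrightarrow> tame (\<lambda>x. c * f x)"
  using tame_mult[OF tame_const] by simp

lemma tame_power [simp, intro]: "tame f \<Longrightarrow> tame (\<lambda>x. f x ^ k)"
  by (induction k) auto

lemma tame_abs [simp, intro]:
  assumes "tame f" shows "tame (\<lambda>x. \<bar>f x\<bar>)"
  using assms by (auto simp: tame_def)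

lemma tame_ln [simp, intro]: "tame ln"
  unfolding tame_def using abs_ln_le_add_inverse(2)
  by (auto intro!: exI[of _ 1] exI[of _ 1])

lemma tame_exp_mult_ln [simp, intro]: "tame (\<lambda>x. exp (s * ln x))"
  unfolding tame_def using exp_mult_ln_le[of _ s]
  by (auto intro!: exI[of _ 1] exI[of _ "nat \<lceil>\<bar>s\<bar>\<rceil>"])

lemma tame_id [simp, intro]: "tame (\<lambda>x. x)"
  unfolding tame_def by (auto intro!: exI[of _ 1] exI[of _ 1])

lemma tame_inverse [simp, intro]: "tame (\<lambda>x. 1 / x)"
  unfolding tame_def by (auto intro!: exI[of _ 1] exI[of _ 1])

lemma inner_gig_stat:
  "\<theta> \<bullet> gig_stat x = fst \<theta> * ln x - fst (snd \<theta>) * x / 2 - snd (snd \<theta>) / (2 * x)"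
  by (simp add: gig_stat_def inner_prod_def)

lemma tame_inner [simp, intro]: "tame (\<lambda>x. \<theta> \<bullet> gig_stat x)"
proof -
  have "tame (\<lambda>x. fst \<theta> * ln x + (- fst (snd \<theta>) / 2) * x + (- snd (snd \<theta>) / 2) * (1 / x))"
    by (intro tame_add tame_cmult tame_ln tame_id tame_inverse)
  moreover have "\<theta> \<bullet> gig_stat x =
      fst \<theta> * ln x + (- fst (snd \<theta>) / 2) * x + (- snd (snd \<theta>) / 2) * (1 / x)" for x
    by (simp add: inner_gig_stat)
  ultimately show ?thesis by simp
qed

text \<open>Through Cauchy-Schwarz this bounds \<open>h \<bullet> gig_stat x\<close> by a multiple
  of norm h, which is what the Taylor estimate of the integrals requires.\<close>

lemma norm_gig_stat_le:
  assumes x: "x > 0"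
  shows "norm (gig_stat x) \<le> 2 * (x + 1 / x)"
proof -
  have "norm (gig_stat x) \<le> \<bar>ln x\<bar> + (\<bar>- x / 2\<bar> + \<bar>- 1 / (2 * x)\<bar>)"
    unfolding gig_stat_def
    by (intro order_trans[OF norm_Pair_le] add_mono order_refl) (auto simp: norm_Pair_le)
  also have "\<bar>- x / 2\<bar> + \<bar>- 1 / (2 * x)\<bar> = (x + 1 / x) / 2"
    using x by (simp add: field_simps)
  finally have "norm (gig_stat x) \<le> \<bar>ln x\<bar> + (x + 1 / x) / 2" .
  moreover note abs_ln_le_add_inverse(2)[OF x]
  moreover have "0 \<le> x + 1 / x" using x by simp
  moreover have "n \<le> 2 * y" if "n \<le> l + y / 2" "l \<le> y" "0 \<le> y" for n l y :: real
    using that by linarith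
  ultimately show ?thesis by blast
qed

section \<open>Integrability of moderate functions against the exponential weights\<close>

lemma power_le_exp:
  fixes c y :: real
  assumes "c > 0" "y \<ge> 0"
  shows "y ^ m \<le> (fact m / c ^ m) * exp (c * y)"
proof -
  have "(\<Sum>n\<in>{m}. (c * y) ^ n /\<^sub>R fact n) \<le> exp (c * y)"
    unfolding exp_def using assms
    by (intro sum_le_suminf summable_exp_generic) auto
  then show ?thesis using assms by (simp add: field_simps power_mult_distrib)
qed

lemma measurable_half_line: "f \<in> borel_measurable borel \<Longrightarrow> f \<in> borel_measurable half_line"
  by (intro measurable_restrict_space1) auto

lemma gig_params_iff: "\<theta> \<in> gig_params \<longleftrightarrow> fst (snd \<theta>) > 0 \<and> snd (snd \<theta>) > 0"
  by (cases \<theta>) (auto simp: gig_params_def)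

lemma measurable_gig_integrand:
  assumes "tame f"
  shows "(\<lambda>x. f x * exp (\<theta> \<bullet> gig_stat x) / x) \<in> borel_measurable half_line"
proof -
  note [measurable] = assms[THEN tame_measurable] tame_inner[of \<theta>, THEN tame_measurable]
  show ?thesis by (intro measurable_half_line) measurable
qed

text \<open>With y = x + 1 / x the weight decays at least like exp (- 2 c y). Half of this rate
  absorbs all polynomial factors in y, and the other half leaves exp (- c x), which is integrable on
  the half-line.\<close>

lemma gig_integrable:
  assumes f: "tame f" and \<theta>: "\<theta> \<in> gig_params"
  shows "integrable half_line (\<lambda>x. f x * exp (\<theta> \<bullet> gig_stat x) / x)"
proof -
  obtain C k where C: "C \<ge> 0" "\<And>x. x > 0 \<Longrightarrow> \<bar>f x\<bar> \<le> C * (x + 1 / x) ^ k"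
    using tame_bound[OF f] by blast
  obtain p a b where \<theta>_eq: "\<theta> = (p, a, b)" by (cases \<theta>) auto
  with \<theta> have ab: "a > 0" "b > 0" by (auto simp: gig_params_iff)
  \<comment> \<open>Chosen so that (a x + b / x) / 2 is at least 2 c (x + 1 / x).\<close>
  define c where "c = min a b / 4"
  have c: "c > 0" "4 * c \<le> a" "4 * c \<le> b" using ab by (auto simp: c_def)
  define N where "N = nat \<lceil>\<bar>p\<bar>\<rceil>"
  \<comment> \<open>The powers of x + 1 / x come from f (k), from exp (p * ln x) (N) and from the
    factor 1 / x (one more).\<close>
  define m where "m = k + N + 1"
  define D where "D = C * (fact m / c ^ m)"
  have D: "D \<ge> 0" using C(1) c by (simp add: D_def)
  have bound: "\<bar>f x * exp (\<theta> \<bullet> gig_stat x) / x\<bar> \<le> D * exp (- (x * c))" if x: "x > 0" for x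
  proof -
    let ?y = "x + 1 / x"
    have y: "?y \<ge> 2" using add_inverse_ge_2[OF x] .
    have 1: "exp (p * ln x) \<le> ?y ^ N"
      unfolding N_def by (rule exp_mult_ln_le[OF x])
    have "2 * c * x \<le> a * x / 2" using c(2) x by (simp add: field_simps)
    moreover have "2 * c / x \<le> b / (2 * x)" using c(3) x by (simp add: field_simps)
    moreover have "2 * c * ?y = 2 * c * x + 2 * c / x" by (simp add: distrib_left)
    ultimately have 2: "exp (- a * x / 2 - b / (2 * x)) \<le> exp (- (2 * c * ?y))"
      unfolding exp_le_cancel_iff by linarith
    have "\<bar>f x * exp (\<theta> \<bullet> gig_stat x) / x\<bar>
        = \<bar>f x\<bar> * (exp (p * ln x) * exp (- a * x / 2 - b / (2 * x))) * (1 / x)"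
      using x by (simp add: \<theta>_eq inner_gig_stat abs_mult exp_diff exp_minus field_simps
          flip: exp_add)
    also have "\<dots> \<le> (C * ?y ^ k) * (?y ^ N * exp (- (2 * c * ?y))) * ?y"
      using x C(2)[OF x] C(1) 1 2 y by (intro mult_mono) auto
    also have "\<dots> = C * ?y ^ m * exp (- (2 * c * ?y))"
      by (simp add: m_def power_add mult_ac)
    also have "\<dots> \<le> C * (fact m / c ^ m * exp (c * ?y)) * exp (- (2 * c * ?y))"
      using C(1) c y by (intro mult_right_mono mult_left_mono power_le_exp) auto
    also have "\<dots> = D * exp (- (c * ?y))"
      by (simp add: D_def flip: exp_add)
    also have "\<dots> \<le> D * exp (- (x * c))"
      using D c(1) x by (intro mult_left_mono) (auto simp: distrib_left)
    finally show ?thesis .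
  qed
  show ?thesis
  proof (rule Bochner_Integration.integrable_bound)
    show "integrable half_line (\<lambda>x. D * exp (- (x * c)))"
      using integrable_I0i_exp_mscale[OF c(1)]
      by (intro integrable_mult_right) (simp add: integrable_restrict_space set_integrable_def)
    show "AE x in half_line. norm (f x * exp (\<theta> \<bullet> gig_stat x) / x) \<le> norm (D * exp (- (x * c)))"
      using bound D by (intro AE_I2) (auto simp: space_restrict_space abs_mult)
  qed (rule measurable_gig_integrand[OF f])
qed

lemma gig_int_add:
  "tame f \<Longrightarrow> tame g \<Longrightarrow> \<theta> \<in> gig_params \<Longrightarrow>
     gig_int (\<lambda>x. f x + g x) \<theta> = gig_int f \<theta> + gig_int g \<theta>"
  unfolding gig_int_def
  using Bochner_Integration.integral_add[OF gig_integrable[of f \<theta>] gig_integrable[of g \<theta>]]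
  by (simp add: distrib_right add_divide_distrib)

lemma gig_int_cmult: "gig_int (\<lambda>x. c * f x) \<theta> = c * gig_int f \<theta>"
  unfolding gig_int_def
  by (subst integral_mult_right_zero[symmetric]) (simp add: mult_ac)

lemma gig_int_mono:
  assumes "tame f" "tame g" "\<theta> \<in> gig_params" "\<And>x. x > 0 \<Longrightarrow> f x \<le> g x"
  shows "gig_int f \<theta> \<le> gig_int g \<theta>"
  unfolding gig_int_def using assms
  by (intro integral_mono gig_integrable)
     (auto simp: space_restrict_space intro!: divide_right_mono mult_right_mono)

text \<open>Exponential tilting is a translation of the parameter. The integrands coincide
  pointwise, so integrability does not enter.\<close>

lemma gig_int_shift:
  assumes "\<And>x. x > 0 \<Longrightarrow> f x = g x * exp (\<eta> \<bullet> gig_stat x)"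
  shows "gig_int f \<theta> = gig_int g (\<theta> + \<eta>)"
  unfolding gig_int_def using assms
  by (intro Bochner_Integration.integral_cong)
     (auto simp: space_restrict_space inner_add_left exp_add mult_ac)

section \<open>Differentiation of the integrals in the parameter\<close>

lemma abs_exp_remainder_le:
  fixes u :: real
  shows "\<bar>exp u - 1 - u\<bar> \<le> u\<^sup>2 * exp \<bar>u\<bar>"
proof -
  have "cmod (exp (of_real u) - (\<Sum>i\<le>1. of_real u ^ i / fact i))
      \<le> exp (norm (of_real u :: complex)) * (norm (of_real u :: complex) ^ Suc 1) / fact 1"
    by (rule Taylor_exp_field)
  also have "exp (of_real u) - (\<Sum>i\<le>1. of_real u ^ i / fact i) = (of_real (exp u - 1 - u) :: complex)"
    by (simp add: exp_of_real)
  finally show ?thesis by (simp add: mult_ac power2_eq_square flip: of_real_diff)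
qed

text \<open>Shrinking \<open>a\<close> and \<open>b\<close> absorbs the exponential factor of the Taylor remainder of
  \<open>exp (h \<bullet> gig_stat x)\<close>, so no dominated convergence argument is needed.\<close>

lemma gig_int_remainder:
  assumes f: "tame f" and \<theta>: "\<theta> \<in> gig_params"
  obtains \<rho> C where "\<rho> > 0" "C \<ge> 0"
    "\<And>h. norm h \<le> \<rho> \<Longrightarrow> \<theta> + h \<in> gig_params"
    "\<And>h. norm h \<le> \<rho> \<Longrightarrow>
       \<bar>gig_int f (\<theta> + h) - gig_int f \<theta> - gig_int (\<lambda>x. f x * (h \<bullet> gig_stat x)) \<theta>\<bar> \<le> C * (norm h)\<^sup>2"
proof -
  obtain p a b where \<theta>_eq: "\<theta> = (p, a, b)" by (cases \<theta>) auto
  with \<theta> have ab: "a > 0" "b > 0" by (auto simp: gig_params_iff)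
  \<comment> \<open>The shift by \<open>\<eta>\<close> lowers a and b by 4 \<rho>, at most half of
    either, so the shifted parameter stays admissible. At the same time \<eta> \<bullet> T equals 2
    \<rho> (x + 1 / x), which dominates |h \<bullet> T| whenever norm h \<le> \<rho>.\<close>
  define \<rho> where "\<rho> = min a b / 8"
  have \<rho>: "\<rho> > 0" "8 * \<rho> \<le> a" "8 * \<rho> \<le> b" using ab by (auto simp: \<rho>_def)
  define \<eta> :: "real \<times> real \<times> real" where "\<eta> = (0, - (4 * \<rho>), - (4 * \<rho>))"
  \<comment> \<open>The factor beside |f| is the square of the bound 2 (x + 1 / x) on the norm of
    the statistic; it comes from the quadratic term of the remainder.\<close>
  define g where "g x = \<bar>f x\<bar> * (4 * (x + 1 / x)\<^sup>2)" for x
  have g: "tame g" unfolding g_def using f by auto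
  have \<theta>': "\<theta> + \<eta> \<in> gig_params" using \<rho> ab by (auto simp: gig_params_iff \<eta>_def \<theta>_eq)
  define C where "C = gig_int g (\<theta> + \<eta>)"
  have in_params: "\<theta> + h \<in> gig_params" if h: "norm h \<le> \<rho>" for h
  proof -
    obtain h1 h2 h3 where h_eq: "h = (h1, h2, h3)" by (cases h) auto
    have "\<bar>h2\<bar> \<le> \<rho>" "\<bar>h3\<bar> \<le> \<rho>"
      using h norm_snd_le[of "(h2, h3)" h1] norm_fst_le[of h2 h3] norm_snd_le[of h3 h2]
      by (auto simp: h_eq)
    then show ?thesis using \<rho> ab by (auto simp: gig_params_iff \<theta>_eq h_eq)
  qed
  have rem: "\<bar>gig_int f (\<theta> + h) - gig_int f \<theta> - gig_int (\<lambda>x. f x * (h \<bullet> gig_stat x)) \<theta>\<bar>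
      \<le> C * (norm h)\<^sup>2" if h: "norm h \<le> \<rho>" for h
  proof -
    let ?r = "\<lambda>x. f x * (exp (h \<bullet> gig_stat x) - 1 - h \<bullet> gig_stat x) * exp (\<theta> \<bullet> gig_stat x) / x"
    have i1: "integrable half_line (\<lambda>x. f x * exp ((\<theta> + h) \<bullet> gig_stat x) / x)"
      by (intro gig_integrable f in_params h)
    have i2: "integrable half_line (\<lambda>x. f x * exp (\<theta> \<bullet> gig_stat x) / x)"
      by (intro gig_integrable f \<theta>)
    have i3: "integrable half_line (\<lambda>x. f x * (h \<bullet> gig_stat x) * exp (\<theta> \<bullet> gig_stat x) / x)"
      by (intro gig_integrable tame_mult tame_inner f \<theta>)
    have r_eq: "?r x = f x * exp ((\<theta> + h) \<bullet> gig_stat x) / x - f x * exp (\<theta> \<bullet> gig_stat x) / x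
        - f x * (h \<bullet> gig_stat x) * exp (\<theta> \<bullet> gig_stat x) / x" for x
      by (simp add: inner_add_left exp_add algebra_simps diff_divide_distrib add_divide_distrib)
    have ir: "integrable half_line ?r"
      unfolding r_eq by (intro Bochner_Integration.integrable_diff i1 i2 i3)
    have int_r: "(\<integral>x. ?r x \<partial>half_line)
        = gig_int f (\<theta> + h) - gig_int f \<theta> - gig_int (\<lambda>x. f x * (h \<bullet> gig_stat x)) \<theta>"
      unfolding r_eq gig_int_def
      by (simp only: Bochner_Integration.integral_diff Bochner_Integration.integrable_diff i1 i2 i3)
    have "\<bar>\<integral>x. ?r x \<partial>half_line\<bar> \<le> (\<integral>x. \<bar>?r x\<bar> \<partial>half_line)"
      by (rule integral_abs_bound)
    also have "\<dots> \<le> (\<integral>x. (norm h)\<^sup>2 * (g x * exp ((\<theta> + \<eta>) \<bullet> gig_stat x) / x) \<partial>half_line)"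
    proof (intro integral_mono Bochner_Integration.integrable_abs ir integrable_mult_right gig_integrable g \<theta>')
      fix x assume "x \<in> space half_line"
      then have x: "x > 0" by (simp add: space_restrict_space)
      let ?u = "h \<bullet> gig_stat x"
      have "\<bar>?u\<bar> \<le> norm h * norm (gig_stat x)" by (rule Cauchy_Schwarz_ineq2)
      also have "\<dots> \<le> norm h * (2 * (x + 1 / x))" 
        by (intro mult_left_mono norm_gig_stat_le x) auto
      finally have u: "\<bar>?u\<bar> \<le> norm h * (2 * (x + 1 / x))" .
      also have "\<dots> \<le> \<rho> * (2 * (x + 1 / x))" using h x by (intro mult_right_mono) auto
      also have "\<dots> = \<eta> \<bullet> gig_stat x" using x by (simp add: \<eta>_def inner_gig_stat field_simps)
      finally have u2: "\<bar>?u\<bar> \<le> \<eta> \<bullet> gig_stat x" .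
      have "?u\<^sup>2 \<le> (norm h * (2 * (x + 1 / x)))\<^sup>2"
        using u by (rule abs_le_square_iff[THEN iffD1, OF order_trans[OF _ abs_ge_self]])
      then have "\<bar>exp ?u - 1 - ?u\<bar> \<le> (norm h * (2 * (x + 1 / x)))\<^sup>2 * exp (\<eta> \<bullet> gig_stat x)"
        using u2 by (intro order_trans[OF abs_exp_remainder_le] mult_mono) auto
      then have "\<bar>?r x\<bar> \<le> \<bar>f x\<bar> * ((norm h * (2 * (x + 1 / x)))\<^sup>2 * exp (\<eta> \<bullet> gig_stat x))
          * exp (\<theta> \<bullet> gig_stat x) / x"
        using x by (auto simp: abs_mult intro!: divide_right_mono mult_right_mono mult_left_mono)
      moreover have sq: "(n * (2 * y))\<^sup>2 = n\<^sup>2 * (4 * y\<^sup>2)" for n y :: real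
        by (simp add: power_mult_distrib)
      have "\<bar>f x\<bar> * ((norm h * (2 * (x + 1 / x)))\<^sup>2 * exp (\<eta> \<bullet> gig_stat x))
          * exp (\<theta> \<bullet> gig_stat x) / x = (norm h)\<^sup>2 * (g x * exp ((\<theta> + \<eta>) \<bullet> gig_stat x) / x)"
        using sq[of "norm h" "x + 1 / x"]
        by (simp del: distrib_left_numeral add: g_def inner_add_left exp_add mult_ac)
      ultimately show "\<bar>?r x\<bar> \<le> (norm h)\<^sup>2 * (g x * exp ((\<theta> + \<eta>) \<bullet> gig_stat x) / x)"
        by (rule ord_le_eq_trans)
    qed
    also have "\<dots> = C * (norm h)\<^sup>2"
      by (subst integral_mult_right_zero) (simp add: C_def gig_int_def)
    finally show ?thesis unfolding int_r .
  qed
  have "C \<ge> 0"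
    unfolding C_def gig_int_def g_def by (intro Bochner_Integration.integral_nonneg_AE AE_I2) (auto simp: space_restrict_space)
  then show ?thesis using that[OF \<rho>(1) _ in_params rem] by auto
qed

lemma gig_int_has_derivative:
  assumes f: "tame f" and \<theta>: "\<theta> \<in> gig_params"
  shows "(gig_int f has_derivative (\<lambda>h. gig_int (\<lambda>x. f x * (h \<bullet> gig_stat x)) \<theta>)) (at \<theta>)"
proof -
  obtain \<rho> C where C: "\<rho> > 0" "C \<ge> 0" 
    "\<And>h. norm h \<le> \<rho> \<Longrightarrow>
       \<bar>gig_int f (\<theta> + h) - gig_int f \<theta> - gig_int (\<lambda>x. f x * (h \<bullet> gig_stat x)) \<theta>\<bar> \<le> C * (norm h)\<^sup>2"
    using gig_int_remainder[OF f \<theta>] by metis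
  have lin: "linear (\<lambda>h. gig_int (\<lambda>x. f x * (h \<bullet> gig_stat x)) \<theta>)"
    using f \<theta> by (intro linearI)
      (simp_all add: inner_add_left distrib_left gig_int_add mult.left_commute gig_int_cmult
        del: times_divide_eq_left)
  show ?thesis
    unfolding has_derivative_at
  proof (intro conjI)
    show "bounded_linear (\<lambda>h. gig_int (\<lambda>x. f x * (h \<bullet> gig_stat x)) \<theta>)"
      using lin by (simp add: linear_conv_bounded_linear)
    show "(\<lambda>h. norm (gig_int f (\<theta> + h) - gig_int f \<theta> - gig_int (\<lambda>x. f x * (h \<bullet> gig_stat x)) \<theta>) / norm h)
        \<midarrow>0\<rightarrow> 0"
    proof (rule Lim_null_comparison)
      show "\<forall>\<^sub>F h in at 0. norm (norm (gig_int f (\<theta> + h) - gig_int f \<theta> - gig_int (\<lambda>x. f x * (h \<bullet> gig_stat x)) \<theta>) / norm h)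
          \<le> C * norm h"
        unfolding eventually_at
      proof (intro exI[of _ \<rho>] conjI C(1) ballI impI)
        fix h :: "real \<times> real \<times> real" assume h: "h \<noteq> 0 \<and> dist h 0 < \<rho>"
        then show "norm (norm (gig_int f (\<theta> + h) - gig_int f \<theta> - gig_int (\<lambda>x. f x * (h \<bullet> gig_stat x)) \<theta>) / norm h)
          \<le> C * norm h"
          using C(3)[of h] by (simp add: divide_le_eq power2_eq_square mult_ac)
      qed
      show "((\<lambda>h. C * norm h) \<longlongrightarrow> 0) (at (0 :: real \<times> real \<times> real))"
        by (intro tendsto_eq_intros) auto
    qed
  qed
qed

lemma gig_int_pos:
  assumes f: "tame f" and \<theta>: "\<theta> \<in> gig_params" and pos: "\<And>x. x > 0 \<Longrightarrow> f x > 0"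
  shows "gig_int f \<theta> > 0"
proof -
  let ?f = "\<lambda>x. f x * exp (\<theta> \<bullet> gig_stat x) / x"
  have *: "x \<in> space half_line \<Longrightarrow> ?f x > 0" for x
    using pos[of x] by (auto simp: space_restrict_space)
  have nn: "AE x in half_line. 0 \<le> ?f x"
    by (intro AE_I2 less_imp_le *)
  have "gig_int f \<theta> \<noteq> 0"
  proof
    assume "gig_int f \<theta> = 0"
    then have "AE x in half_line. ?f x = 0"
      using integral_nonneg_eq_0_iff_AE[OF gig_integrable[OF f \<theta>] nn] by (simp add: gig_int_def)
    then have "AE x in half_line. False"
      by (rule AE_mp) (intro AE_I2, use * in force)
    then have "emeasure half_line (space half_line) = 0"
    proof -
      from \<open>AE x in half_line. False\<close> have "AE x in half_line. x \<notin> space half_line"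
        by eventually_elim simp
      then have "space half_line \<in> null_sets half_line"
        using AE_iff_null_sets[OF sets.top[of half_line]] by blast
      then show ?thesis by (simp only: null_sets_def mem_Collect_eq)
    qed
    \<comment> \<open>The half-line contains an interval of length one, so it is not a null
      set.\<close>
    moreover have "emeasure lborel {0<..(1::real)} \<le> emeasure lborel {0::real<..}"
      by (intro emeasure_mono) auto
    ultimately show False
      by (simp add: space_restrict_space emeasure_restrict_space)
  qed
  moreover have "gig_int f \<theta> \<ge> 0"
    unfolding gig_int_def by (intro integral_nonneg_AE nn)
  ultimately show ?thesis by simp
qed

section \<open>Means and covariances as smooth functions of the parameter\<close>

abbreviation gig_norm :: "real \<times> real \<times> real \<Rightarrow> real" where
  "gig_norm \<equiv> gig_int (\<lambda>x. 1)"

lemma gig_norm_pos: "\<theta> \<in> gig_params \<Longrightarrow> gig_norm \<theta> > 0"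
  by (intro gig_int_pos) auto

text \<open>Written as a quotient of integrals over a fixed measure, so that the parameter is an
  explicit argument and the quotient rule applies; \<open>integral_gig\<close> identifies it with
  the expectation under the law.\<close>

definition gig_E :: "real \<times> real \<times> real \<Rightarrow> (real \<Rightarrow> real) \<Rightarrow> real" where
  "gig_E \<theta> f = gig_int f \<theta> / gig_norm \<theta>"

definition gig_cov :: "real \<times> real \<times> real \<Rightarrow> (real \<Rightarrow> real) \<Rightarrow> (real \<Rightarrow> real) \<Rightarrow> real" where
  "gig_cov \<theta> f g = gig_E \<theta> (\<lambda>x. f x * g x) - gig_E \<theta> f * gig_E \<theta> g"

lemma gig_E_const [simp]: "\<theta> \<in> gig_params \<Longrightarrow> gig_E \<theta> (\<lambda>x. c) = c"
  using gig_int_cmult[of c "\<lambda>x. 1" \<theta>] gig_norm_pos[of \<theta>] by (simp add: gig_E_def)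

lemma gig_E_add:
  "tame f \<Longrightarrow> tame g \<Longrightarrow> \<theta> \<in> gig_params \<Longrightarrow> gig_E \<theta> (\<lambda>x. f x + g x) = gig_E \<theta> f + gig_E \<theta> g"
  by (simp add: gig_E_def gig_int_add add_divide_distrib)

lemma gig_E_cmult: "gig_E \<theta> (\<lambda>x. c * f x) = c * gig_E \<theta> f"
  by (simp add: gig_E_def gig_int_cmult)

lemma gig_E_diff:
  "tame f \<Longrightarrow> tame g \<Longrightarrow> \<theta> \<in> gig_params \<Longrightarrow> gig_E \<theta> (\<lambda>x. f x - g x) = gig_E \<theta> f - gig_E \<theta> g"
  using gig_E_add[of f "\<lambda>x. (-1) * g x" \<theta>] gig_E_cmult[of \<theta> "-1" g] by simp

lemma gig_E_mono:
  "tame f \<Longrightarrow> tame g \<Longrightarrow> \<theta> \<in> gig_params \<Longrightarrow> (\<And>x. x > 0 \<Longrightarrow> f x \<le> g x) \<Longrightarrow> gig_E \<theta> f \<le> gig_E \<theta> g"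
  unfolding gig_E_def using gig_norm_pos[of \<theta>]
  by (intro divide_right_mono gig_int_mono) auto

lemma gig_cov_sym: "gig_cov \<theta> f g = gig_cov \<theta> g f"
  by (simp add: gig_cov_def mult.commute)

lemma gig_cov_cmult_left: "gig_cov \<theta> (\<lambda>x. c * f x) g = c * gig_cov \<theta> f g"
  using gig_E_cmult[of \<theta> c "\<lambda>x. f x * g x"]
  by (simp add: gig_cov_def gig_E_cmult right_diff_distrib mult_ac)

lemma gig_cov_diff_left:
  "tame f \<Longrightarrow> tame f' \<Longrightarrow> tame g \<Longrightarrow> \<theta> \<in> gig_params \<Longrightarrow>
    gig_cov \<theta> (\<lambda>x. f x - f' x) g = gig_cov \<theta> f g - gig_cov \<theta> f' g"
  by (simp add: gig_cov_def left_diff_distrib gig_E_diff)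

lemma gig_cov_diff_right:
  "tame f \<Longrightarrow> tame f' \<Longrightarrow> tame g \<Longrightarrow> \<theta> \<in> gig_params \<Longrightarrow>
    gig_cov \<theta> g (\<lambda>x. f x - f' x) = gig_cov \<theta> g f - gig_cov \<theta> g f'"
  using gig_cov_diff_left[of f f' g \<theta>] by (simp add: gig_cov_sym[of \<theta> g])

lemma gig_cov_cmult_right: "gig_cov \<theta> g (\<lambda>x. c * f x) = c * gig_cov \<theta> g f"
  using gig_cov_cmult_left[of \<theta> c f g] by (simp add: gig_cov_sym[of \<theta> g])

lemma gig_cov_self:
  assumes "tame f" "\<theta> \<in> gig_params"
  shows "gig_cov \<theta> f f = gig_E \<theta> (\<lambda>x. (f x - gig_E \<theta> f)\<^sup>2)"
proof -
  let ?m = "gig_E \<theta> f"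
  have "gig_E \<theta> (\<lambda>x. (f x - ?m)\<^sup>2) = gig_E \<theta> (\<lambda>x. f x * f x - (2 * ?m) * f x + ?m * ?m)"
    by (intro arg_cong[where f = "gig_E \<theta>"] ext) (simp add: power2_eq_square algebra_simps)
  also have "\<dots> = gig_E \<theta> (\<lambda>x. f x * f x) - 2 * ?m * ?m + ?m * ?m"
    using assms by (simp add: gig_E_add gig_E_diff gig_E_cmult del: mult.assoc)
  finally show ?thesis by (simp add: gig_cov_def)
qed

lemma open_gig_params: "open gig_params"
  unfolding gig_params_def by (intro open_Times) auto

text \<open>In the quotient rule the numerator contributes the mixed moment and the normaliser the
  product of means. Applied to the sufficient statistics this yields the information matrix, applied
  to the efficient score it yields the drift under the alternatives.\<close>

lemma gig_E_has_derivative: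
  assumes f: "tame f" and \<theta>: "\<theta> \<in> gig_params"
  shows "((\<lambda>\<theta>. gig_E \<theta> f) has_derivative (\<lambda>h. gig_cov \<theta> f (\<lambda>x. h \<bullet> gig_stat x))) (at \<theta>)"
proof -
  have "gig_norm \<theta> \<noteq> 0" using gig_norm_pos[OF \<theta>] by simp
  then show ?thesis
    unfolding gig_E_def
    by (auto intro!: derivative_eq_intros gig_int_has_derivative f \<theta>
        simp: gig_cov_def gig_E_def fun_eq_iff field_simps power2_eq_square)
qed

lemma gig_E_continuous_on:
  assumes "tame f" shows "continuous_on gig_params (\<lambda>\<theta>. gig_E \<theta> f)"
  using has_derivative_continuous[OF gig_E_has_derivative[OF assms]]
  by (intro continuous_at_imp_continuous_on) auto

lemma gig_cov_continuous_on:
  assumes "tame f" "tame g" shows "continuous_on gig_params (\<lambda>\<theta>. gig_cov \<theta> f g)"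
  unfolding gig_cov_def
  by (intro continuous_intros gig_E_continuous_on tame_mult assms)

definition gig_lognorm :: "real \<times> real \<times> real \<Rightarrow> real" where
  "gig_lognorm \<theta> = ln (gig_norm \<theta>)"

lemma gig_lognorm_has_derivative:
  assumes \<theta>: "\<theta> \<in> gig_params"
  shows "((\<lambda>\<theta>. gig_lognorm \<theta>) has_derivative (\<lambda>h. gig_E \<theta> (\<lambda>x. h \<bullet> gig_stat x))) (at \<theta>)"
  unfolding gig_lognorm_def
  using gig_norm_pos[OF \<theta>] gig_int_has_derivative[OF tame_const[of 1] \<theta>]
  by (auto intro!: derivative_eq_intros simp: gig_E_def fun_eq_iff field_simps)

section \<open>Coordinates of the sufficient statistic and partial derivatives\<close>

definition stat_a :: "real \<Rightarrow> real" where "stat_a x = - x / 2"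
definition stat_b :: "real \<Rightarrow> real" where "stat_b x = - 1 / (2 * x)"

lemma tame_stat_a [simp, intro]: "tame stat_a"
  using tame_cmult[OF tame_id, of "-1/2"] by (simp add: stat_a_def[abs_def])

lemma tame_stat_b [simp, intro]: "tame stat_b"
  using tame_cmult[OF tame_inverse, of "-1/2"] by (simp add: stat_b_def[abs_def])

lemma inner_gig_stat_Pair: "(u, v, w) \<bullet> gig_stat x = u * ln x + v * stat_a x + w * stat_b x"
  by (simp add: inner_gig_stat stat_a_def stat_b_def)

text \<open>The quantities of the model are built from one-variable \<open>deriv\<close>, so Frechet
  derivatives are restricted to coordinate lines.\<close>

lemma DERIV_along_line:
  fixes F :: "'a::real_normed_vector \<Rightarrow> real"
  assumes F: "(F has_derivative D) (at (\<gamma> t))" and \<gamma>: "(\<gamma> has_derivative (\<lambda>h. h *\<^sub>R v)) (at t)"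
    and "D v = d"
  shows "((\<lambda>t. F (\<gamma> t)) has_real_derivative d) (at t)"
proof -
  have "linear D" using has_derivative_linear[OF F] .
  then have "(\<lambda>h. D (h *\<^sub>R v)) = (*) d"
    using assms(3) by (auto simp: linear_scale mult.commute)
  then show ?thesis
    using has_derivative_compose[OF \<gamma> F] by (simp add: has_field_derivative_def)
qed

lemma has_derivative_p_line: "((\<lambda>t. (t, a, b)) has_derivative (\<lambda>h. h *\<^sub>R (1, 0, 0))) (at p)"
  and has_derivative_a_line: "((\<lambda>t. (p, t, b)) has_derivative (\<lambda>h. h *\<^sub>R (0, 1, 0))) (at a)"
  and has_derivative_b_line: "((\<lambda>t. (p, a, t)) has_derivative (\<lambda>h. h *\<^sub>R (0, 0, 1))) (at b)"
  for p a b :: real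
  by (auto intro!: derivative_eq_intros simp: zero_prod_def)

lemma gig_E_DERIV:
  assumes "tame f" "a > 0" "b > 0"
  shows "((\<lambda>t. gig_E (t, a, b) f) has_real_derivative gig_cov (p, a, b) f ln) (at p)"
    and "((\<lambda>t. gig_E (p, t, b) f) has_real_derivative gig_cov (p, a, b) f stat_a) (at a)"
    and "((\<lambda>t. gig_E (p, a, t) f) has_real_derivative gig_cov (p, a, b) f stat_b) (at b)"
  using assms
  by (auto intro!: DERIV_along_line[OF gig_E_has_derivative has_derivative_p_line]
      DERIV_along_line[OF gig_E_has_derivative has_derivative_a_line]
      DERIV_along_line[OF gig_E_has_derivative has_derivative_b_line]
      simp: gig_params_iff inner_gig_stat_Pair)

lemma gig_lognorm_DERIV:
  assumes "a > 0" "b > 0"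
  shows "((\<lambda>t. gig_lognorm (t, a, b)) has_real_derivative gig_E (p, a, b) ln) (at p)"
    and "((\<lambda>t. gig_lognorm (p, t, b)) has_real_derivative gig_E (p, a, b) stat_a) (at a)"
    and "((\<lambda>t. gig_lognorm (p, a, t)) has_real_derivative gig_E (p, a, b) stat_b) (at b)"
  using assms
  by (auto intro!: DERIV_along_line[OF gig_lognorm_has_derivative has_derivative_p_line]
      DERIV_along_line[OF gig_lognorm_has_derivative has_derivative_a_line]
      DERIV_along_line[OF gig_lognorm_has_derivative has_derivative_b_line]
      simp: gig_params_iff inner_gig_stat_Pair)

section \<open>Score and Fisher information\<close>

text \<open>A change of scale that makes the coefficients of x and 1 / x equal produces the Bessel
  integral. This is the bridge from derivatives of log K to moments.\<close>

lemma gig_norm_eq_besselK: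
  assumes ab: "a > 0" "b > 0"
  shows "gig_norm (p, a, b) = (b / a) powr (p / 2) * (2 * besselK p (sqrt (a * b)))"
proof -
  \<comment> \<open>With x = c t both a x and b / x acquire the coefficient sqrt (a b), and x powr p
    releases the prefactor c powr p; dx / x is unchanged by scaling.\<close>
  define c where "c = sqrt (b / a)"
  have c: "c > 0" using ab by (simp add: c_def)
  let ?f = "\<lambda>x. indicator {0<..} x *\<^sub>R (exp ((p, a, b) \<bullet> gig_stat x) / x)"
  have c2: "c * c = b / a" using ab by (simp add: c_def)
  have ac: "a * c = sqrt (a * b)" "b / c = sqrt (a * b)"
    using ab by (simp_all add: c_def real_sqrt_divide real_sqrt_mult field_simps)
  have cp: "c powr p = (b / a) powr (p / 2)"
    using ab by (simp add: c_def powr_half_sqrt[symmetric] powr_powr)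
  have eq: "c * ?f (c * t) = (b / a) powr (p / 2) *
      (indicator {0<..} t * (t powr (p - 1) * exp (- sqrt (a * b) * (t + 1 / t) / 2)))" for t
  proof (cases "t > 0")
    case True
    have "c * ?f (c * t) = exp (p * ln (c * t) - a * (c * t) / 2 - b / (2 * (c * t))) / t"
      using c True by (simp add: inner_gig_stat)
    also have "a * (c * t) = sqrt (a * b) * t" using ac by (simp add: mult.assoc[symmetric])
    also have "b / (2 * (c * t)) = sqrt (a * b) / (2 * t)"
      using c True by (simp add: ac(2)[symmetric])
    also have "exp (p * ln (c * t) - sqrt (a * b) * t / 2 - sqrt (a * b) / (2 * t)) / t
        = exp (p * ln (c * t)) * exp (- sqrt (a * b) * (t + 1 / t) / 2) / t"
      using True by (simp add: field_simps flip: exp_add)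
    also have "exp (p * ln (c * t)) = c powr p * t powr p"
      using c True by (simp add: powr_def ln_mult distrib_left exp_add)
    also have "t powr p = t powr (p - 1) * t"
      using True by (simp add: powr_diff)
    finally show ?thesis using True by (simp add: cp)
  next
    case False
    then show ?thesis using c by (simp add: zero_less_mult_iff)
  qed
  have "gig_norm (p, a, b) = (\<integral>x. ?f x \<partial>lborel)"
    unfolding gig_int_def by (subst integral_restrict_space) auto
  also have "\<dots> = c * (\<integral>t. ?f (c * t) \<partial>lborel)"
    using lborel_integral_real_affine[of c ?f 0] c by (simp only: real_scaleR_def add_0 abs_of_pos)
  also have "\<dots> = (\<integral>t. c * ?f (c * t) \<partial>lborel)"
    by (rule integral_mult_right_zero[symmetric])
  also have "\<dots> = (b / a) powr (p / 2) * (2 * besselK p (sqrt (a * b)))"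
    unfolding eq by (subst integral_mult_right_zero) (simp add: besselK_def set_lebesgue_integral_def)
  finally show ?thesis .
qed

lemma besselK_pos:
  assumes ab: "a > 0" "b > 0" shows "besselK p (sqrt (a * b)) > 0"
  using gig_norm_pos[of "(p, a, b)"] gig_norm_eq_besselK[OF ab, of p] ab
  by (simp add: gig_params_iff zero_less_mult_iff)

lemma logK_eq:
  assumes ab: "a > 0" "b > 0"
  shows "logK p a b = gig_lognorm (p, a, b) - p / 2 * (ln b - ln a) - ln 2"
  unfolding logK_def gig_lognorm_def gig_norm_eq_besselK[OF ab] using besselK_pos[OF ab, of p] ab
  by (simp add: ln_mult ln_powr ln_div)

lemma logK_p_eq:
  assumes ab: "a > 0" "b > 0"
  shows "logK_p p a b = gig_E (p, a, b) ln - (ln b - ln a) / 2"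
  unfolding logK_p_def logK_eq[OF ab]
  by (intro DERIV_imp_deriv) (auto intro!: derivative_eq_intros gig_lognorm_DERIV ab)

text \<open>The formulas for log K hold for positive a and b only. A derivative is local, so
  agreement on the open half-line is enough.\<close>

lemma deriv_eq_on_half_line:
  fixes f g :: "real \<Rightarrow> real"
  assumes "(g has_real_derivative d) (at t)" "t > 0" "\<And>s. s > 0 \<Longrightarrow> f s = g s"
  shows "deriv f t = d"
  using assms
  by (intro DERIV_imp_deriv has_field_derivative_transform_within_open[of g d t "{0<..}" f]) auto

lemma logK_a_eq:
  assumes ab: "a > 0" "b > 0"
  shows "logK_a p a b = gig_E (p, a, b) stat_a + p / (2 * a)"
  unfolding logK_a_def
  by (rule deriv_eq_on_half_line[OF _ ab(1) logK_eq[OF _ ab(2)]])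
     (use ab in \<open>auto intro!: derivative_eq_intros gig_lognorm_DERIV\<close>)

lemma logK_b_eq:
  assumes ab: "a > 0" "b > 0"
  shows "logK_b p a b = gig_E (p, a, b) stat_b - p / (2 * b)"
  unfolding logK_b_def
  by (rule deriv_eq_on_half_line[OF _ ab(2) logK_eq[OF ab(1)]])
     (use ab in \<open>auto intro!: derivative_eq_intros gig_lognorm_DERIV\<close>)

text \<open>The explicit terms in the central sequence cancel the derivatives of the elementary part
  of log K in \<open>logK_eq\<close>; what remains of each summand is a statistic minus its
  mean.\<close>

lemma Delta_eq:
  assumes ab: "a > 0" "b > 0"
  shows "Delta_p n x p a b = (\<Sum>i<n. ln (x i) - gig_E (p, a, b) ln) / sqrt (real n)"
    and "Delta_a n x p a b = (\<Sum>i<n. stat_a (x i) - gig_E (p, a, b) stat_a) / sqrt (real n)"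
    and "Delta_b n x p a b = (\<Sum>i<n. stat_b (x i) - gig_E (p, a, b) stat_b) / sqrt (real n)"
  unfolding Delta_p_def Delta_a_def Delta_b_def logK_p_eq[OF ab] logK_a_eq[OF ab] logK_b_eq[OF ab]
  using ab
  by (auto simp: ln_div stat_a_def stat_b_def field_simps
      intro!: arg_cong2[where f = "(/)"] sum.cong)

text \<open>First derivatives of log K are means up to elementary terms, and derivatives of means
  are covariances. The rational corrections in the information matrix cancel the derivatives of
  those elementary terms.\<close>

lemma Gamma_eq:
  assumes ab: "a > 0" "b > 0"
  shows "Gamma_pp p a b = gig_cov (p, a, b) ln ln"
    and "Gamma_pa p a b = gig_cov (p, a, b) ln stat_a"
    and "Gamma_pb p a b = gig_cov (p, a, b) ln stat_b"
    and "Gamma_aa p a b = gig_cov (p, a, b) stat_a stat_a"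
    and "Gamma_ab p a b = gig_cov (p, a, b) stat_b stat_a"
    and "Gamma_bb p a b = gig_cov (p, a, b) stat_b stat_b"
proof -
  show "Gamma_pp p a b = gig_cov (p, a, b) ln ln"
    unfolding Gamma_pp_def logK_p_eq[OF ab]
    by (intro DERIV_imp_deriv) (auto intro!: derivative_eq_intros gig_E_DERIV ab)
  have "deriv (\<lambda>a'. logK_p p a' b) a = gig_cov (p, a, b) ln stat_a + 1 / (2 * a)"
    by (rule deriv_eq_on_half_line[OF _ ab(1) logK_p_eq[OF _ ab(2)]])
       (use ab in \<open>auto intro!: derivative_eq_intros gig_E_DERIV\<close>)
  then show "Gamma_pa p a b = gig_cov (p, a, b) ln stat_a"
    by (simp add: Gamma_pa_def)
  have "deriv (\<lambda>b'. logK_p p a b') b = gig_cov (p, a, b) ln stat_b - 1 / (2 * b)"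
    by (rule deriv_eq_on_half_line[OF _ ab(2) logK_p_eq[OF ab(1)]])
       (use ab in \<open>auto intro!: derivative_eq_intros gig_E_DERIV\<close>)
  then show "Gamma_pb p a b = gig_cov (p, a, b) ln stat_b"
    by (simp add: Gamma_pb_def)
  have "deriv (\<lambda>a'. logK_a p a' b) a = gig_cov (p, a, b) stat_a stat_a - p / (2 * a\<^sup>2)"
    by (rule deriv_eq_on_half_line[OF _ ab(1) logK_a_eq[OF _ ab(2)]])
       (use ab in \<open>auto intro!: derivative_eq_intros gig_E_DERIV simp: power2_eq_square\<close>)
  then show "Gamma_aa p a b = gig_cov (p, a, b) stat_a stat_a"
    by (simp add: Gamma_aa_def)
  show "Gamma_ab p a b = gig_cov (p, a, b) stat_b stat_a"
    unfolding Gamma_ab_def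
    by (rule deriv_eq_on_half_line[OF _ ab(1) logK_b_eq[OF _ ab(2)]])
       (use ab in \<open>auto intro!: derivative_eq_intros gig_E_DERIV\<close>)
  have "deriv (\<lambda>b'. logK_b p a b') b = gig_cov (p, a, b) stat_b stat_b + p / (2 * b\<^sup>2)"
    by (rule deriv_eq_on_half_line[OF _ ab(2) logK_b_eq[OF ab(1)]])
       (use ab in \<open>auto intro!: derivative_eq_intros gig_E_DERIV simp: power2_eq_square\<close>)
  then show "Gamma_bb p a b = gig_cov (p, a, b) stat_b stat_b"
    by (simp add: Gamma_bb_def)
qed

text \<open>Zero variance would make v \<bullet> T constant almost everywhere. By continuity the
  exceptional set is open, and an open null set is empty, so v \<bullet> T would be constant on the
  whole half-line; evaluation at a few points then forces v = 0.\<close>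

lemma gig_cov_pos:
  assumes \<theta>: "\<theta> \<in> gig_params" and v: "v \<noteq> 0"
  shows "gig_cov \<theta> (\<lambda>x. v \<bullet> gig_stat x) (\<lambda>x. v \<bullet> gig_stat x) > 0"
proof -
  define m where "m = gig_E \<theta> (\<lambda>x. v \<bullet> gig_stat x)"
  define q where "q x = v \<bullet> gig_stat x - m" for x
  have tq: "tame (\<lambda>x. (q x)\<^sup>2)" unfolding q_def by auto
  let ?f = "\<lambda>x. (q x)\<^sup>2 * exp (\<theta> \<bullet> gig_stat x) / x"
  have nn: "AE x in half_line. 0 \<le> ?f x"
    by (intro AE_I2) (auto simp: space_restrict_space)
  have cov: "gig_cov \<theta> (\<lambda>x. v \<bullet> gig_stat x) (\<lambda>x. v \<bullet> gig_stat x) = gig_int (\<lambda>x. (q x)\<^sup>2) \<theta> / gig_norm \<theta>"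
    using \<theta> by (simp add: gig_cov_self q_def m_def gig_E_def)
  have "gig_int (\<lambda>x. (q x)\<^sup>2) \<theta> \<noteq> 0"
  proof
    assume "gig_int (\<lambda>x. (q x)\<^sup>2) \<theta> = 0"
    then have "AE x in half_line. ?f x = 0"
      using integral_nonneg_eq_0_iff_AE[OF gig_integrable[OF tq \<theta>] nn] by (simp add: gig_int_def)
    then have "AE x in half_line. q x = 0"
      by (rule AE_mp) (intro AE_I2, auto simp: space_restrict_space)
    then have ae: "AE x in lborel. \<not> (x > 0 \<and> q x \<noteq> 0)"
      by (subst (asm) AE_restrict_space_iff) auto
    let ?U = "{x \<in> {0<..}. q x \<noteq> 0}"
    have "continuous_on {0<..} q"
      unfolding q_def inner_gig_stat by (intro continuous_intros) auto
    then have "open ({0<..} \<inter> q -` (- {0}))"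
      by (rule continuous_open_preimage) auto
    moreover have "?U = {0<..} \<inter> q -` (- {0})" by auto
    ultimately have "open ?U" by simp
    have "negligible ?U"
    proof -
      have "?U \<in> sets lborel" using \<open>open ?U\<close> by auto
      then have "?U \<in> null_sets lborel"
        using ae AE_iff_null_sets[of ?U lborel] by auto
      then show ?thesis
        by (simp add: negligible_iff_null_sets null_sets_completionI)
    qed
    with \<open>open ?U\<close> have "?U = {}" using open_not_negligible by blast
    then have q0: "q x = 0" if "x > 0" for x using that by auto
    obtain v1 v2 v3 where v_eq: "v = (v1, v2, v3)" by (cases v) auto
    have ln4: "ln 4 = 2 * ln (2::real)" using ln_realpow[of 2 2] by simp
    have "v1 * ln x - v2 * x / 2 - v3 / (2 * x) - m = 0" if "x > 0" for x
      using q0[OF that] by (simp add: q_def v_eq inner_gig_stat)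
    \<comment> \<open>At powers of 2 all logarithms are multiples of ln 2, so the conditions are
      linear in v1 * ln 2, v2, v3 and m, and linear arithmetic decides them.\<close>
    from this[of 1] this[of 2] this[of "1/2"] this[of 4] this[of "1/4"]
    have "- v2 / 2 - v3 / 2 = m" "v1 * ln 2 - v2 - v3 / 4 = m" "- (v1 * ln 2) - v2 / 4 - v3 = m"
      "2 * (v1 * ln 2) - 2 * v2 - v3 / 8 = m" "- (2 * (v1 * ln 2)) - v2 / 8 - 2 * v3 = m"
      by (simp_all add: ln_div ln4)
    then have "v2 = 0" "v3 = 0" "v1 * ln 2 = 0" by linarith+
    then show False using v by (simp add: v_eq zero_prod_def)
  qed
  moreover have "gig_int (\<lambda>x. (q x)\<^sup>2) \<theta> \<ge> 0"
    unfolding gig_int_def by (intro integral_nonneg_AE nn)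
  ultimately show ?thesis
    unfolding cov using gig_norm_pos[OF \<theta>] by simp
qed


section \<open>The efficient score as a regression residual\<close>

definition eff_det :: "real \<times> real \<times> real \<Rightarrow> real" where
  "eff_det \<theta> = gig_cov \<theta> stat_a stat_a * gig_cov \<theta> stat_b stat_b - (gig_cov \<theta> stat_b stat_a)\<^sup>2"

text \<open>Together with \<open>eff_coeff_b\<close> this is Cramer's solution of the normal
  equations for the regression of ln on \<open>stat_a\<close> and \<open>stat_b\<close>.\<close>

definition eff_coeff_a :: "real \<times> real \<times> real \<Rightarrow> real" where
  "eff_coeff_a \<theta> = (gig_cov \<theta> ln stat_a * gig_cov \<theta> stat_b stat_b
     - gig_cov \<theta> ln stat_b * gig_cov \<theta> stat_b stat_a) / eff_det \<theta>"

definition eff_coeff_b :: "real \<times> real \<times> real \<Rightarrow> real" where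
  "eff_coeff_b \<theta> = (gig_cov \<theta> ln stat_b * gig_cov \<theta> stat_a stat_a
     - gig_cov \<theta> ln stat_a * gig_cov \<theta> stat_b stat_a) / eff_det \<theta>"

text \<open>The residual of ln in that regression, left uncentred: covariances ignore constants, and
  the centring is made explicit where sums are formed.\<close>

definition eff_score :: "real \<times> real \<times> real \<Rightarrow> real \<Rightarrow> real" where
  "eff_score \<theta> x = ln x - eff_coeff_a \<theta> * stat_a x - eff_coeff_b \<theta> * stat_b x"

lemma tame_eff_score [simp, intro]: "tame (eff_score \<theta>)"
  unfolding eff_score_def[abs_def] by (intro tame_diff tame_cmult) auto

text \<open>A Schur complement argument: the determinant of the nuisance block divided by the
  variance of \<open>stat_a\<close> is the variance of the residual of \<open>stat_b\<close>
  regressed on \<open>stat_a\<close>, which is positive by linear independence.\<close>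

lemma eff_det_pos:
  assumes \<theta>: "\<theta> \<in> gig_params" shows "eff_det \<theta> > 0"
proof -
  have aa: "gig_cov \<theta> stat_a stat_a > 0"
    using gig_cov_pos[OF \<theta>, of "(0, 1, 0)"] by (simp add: inner_gig_stat_Pair zero_prod_def)
  define k where "k = gig_cov \<theta> stat_b stat_a / gig_cov \<theta> stat_a stat_a"
  let ?g = "\<lambda>x. stat_b x - k * stat_a x"
  have "gig_cov \<theta> ?g ?g > 0"
    using gig_cov_pos[OF \<theta>, of "(0, - k, 1)"] by (simp add: inner_gig_stat_Pair zero_prod_def)
  also have "gig_cov \<theta> ?g ?g = gig_cov \<theta> stat_b stat_b - 2 * k * gig_cov \<theta> stat_b stat_a
      + k * k * gig_cov \<theta> stat_a stat_a"
    using \<theta>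
    by (simp add: gig_cov_diff_left gig_cov_diff_right gig_cov_cmult_left gig_cov_cmult_right
        gig_cov_sym[of \<theta> stat_a stat_b] algebra_simps)
  also have "\<dots> = eff_det \<theta> / gig_cov \<theta> stat_a stat_a"
    using aa by (simp add: eff_det_def k_def field_simps power2_eq_square)
  finally show ?thesis using aa by (simp add: zero_less_divide_iff)
qed

lemma eff_score_cov:
  assumes "tame g" "\<theta> \<in> gig_params"
  shows "gig_cov \<theta> (eff_score \<theta>) g
    = gig_cov \<theta> ln g - eff_coeff_a \<theta> * gig_cov \<theta> stat_a g - eff_coeff_b \<theta> * gig_cov \<theta> stat_b g"
  using assms by (simp add: eff_score_def[abs_def] gig_cov_diff_left gig_cov_cmult_left)

lemma eff_score_orthogonal:
  assumes \<theta>: "\<theta> \<in> gig_params"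
  shows "gig_cov \<theta> (eff_score \<theta>) stat_a = 0" and "gig_cov \<theta> (eff_score \<theta>) stat_b = 0"
proof -
  \<comment> \<open>The normal equations are verified for plain real numbers, with D for the
    determinant; the covariances are substituted afterwards.\<close>
  have *: "pa - (pa * bb - pb * ab) / D * aa - (pb * aa - pa * ab) / D * ab = 0"
    "pb - (pa * bb - pb * ab) / D * ab - (pb * aa - pa * ab) / D * bb = 0"
    if "D > 0" "D = aa * bb - ab\<^sup>2" for pa pb aa ab bb D :: real
  proof -
    have **: "x - u / D * y - v / D * z = (x * D - u * y - v * z) / D" if "D > 0" for x y z u v D :: real
      using that by (simp add: field_simps)
    have "pa * D - (pa * bb - pb * ab) * aa - (pb * aa - pa * ab) * ab = 0"
      "pb * D - (pa * bb - pb * ab) * ab - (pb * aa - pa * ab) * bb = 0"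
      by (simp_all add: that(2) power2_eq_square algebra_simps)
    then show "pa - (pa * bb - pb * ab) / D * aa - (pb * aa - pa * ab) / D * ab = 0"
      "pb - (pa * bb - pb * ab) / D * ab - (pb * aa - pa * ab) / D * bb = 0"
      using that(1) **[of D] by simp_all
  qed
  show "gig_cov \<theta> (eff_score \<theta>) stat_a = 0" and "gig_cov \<theta> (eff_score \<theta>) stat_b = 0"
    using *[OF eff_det_pos[OF \<theta>] eff_det_def] \<theta>
    by (simp_all add: eff_score_cov eff_coeff_a_def eff_coeff_b_def gig_cov_sym[of \<theta> stat_a stat_b])
qed

text \<open>The efficient score differs from ln by a combination of statistics to which it is
  orthogonal. Hence one number is both its variance, which scales the central limit theorem, and the
  derivative of its mean in p, which produces the shift.\<close>

lemma eff_score_cov_ln: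
  assumes \<theta>: "\<theta> \<in> gig_params"
  shows "gig_cov \<theta> (eff_score \<theta>) (eff_score \<theta>) = gig_cov \<theta> (eff_score \<theta>) ln"
proof -
  have "gig_cov \<theta> (eff_score \<theta>) (eff_score \<theta>)
      = gig_cov \<theta> (eff_score \<theta>) (\<lambda>x. ln x - eff_coeff_a \<theta> * stat_a x - eff_coeff_b \<theta> * stat_b x)"
    by (simp add: eff_score_def[abs_def])
  then show ?thesis
    using \<theta> by (simp add: gig_cov_diff_right gig_cov_cmult_right eff_score_orthogonal)
qed

lemma eff_score_cov_pos:
  assumes \<theta>: "\<theta> \<in> gig_params"
  shows "gig_cov \<theta> (eff_score \<theta>) ln > 0"
proof -
  have "eff_score \<theta> = (\<lambda>x. (1, - eff_coeff_a \<theta>, - eff_coeff_b \<theta>) \<bullet> gig_stat x)"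
    by (simp add: fun_eq_iff eff_score_def inner_gig_stat_Pair)
  then show ?thesis
    using gig_cov_pos[OF \<theta>, of "(1, - eff_coeff_a \<theta>, - eff_coeff_b \<theta>)"] eff_score_cov_ln[OF \<theta>]
    by (simp add: zero_prod_def)
qed

text \<open>Expanding the determinant along its first row and dividing by the determinant of the
  nuisance block gives the variance of ln minus the part explained by the regression.\<close>

lemma Gamma_eff_eq:
  assumes ab: "a > 0" "b > 0"
  shows "Gamma_eff p a b = gig_cov (p, a, b) (eff_score (p, a, b)) ln"
proof -
  let ?\<theta> = "(p, a, b)"
  have \<theta>: "?\<theta> \<in> gig_params" using ab by (simp add: gig_params_iff)
  have "Gamma_eff p a b = (gig_cov ?\<theta> ln ln * eff_det ?\<theta>
      - gig_cov ?\<theta> ln stat_a * (gig_cov ?\<theta> ln stat_a * gig_cov ?\<theta> stat_b stat_b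
          - gig_cov ?\<theta> ln stat_b * gig_cov ?\<theta> stat_b stat_a)
      - gig_cov ?\<theta> ln stat_b * (gig_cov ?\<theta> ln stat_b * gig_cov ?\<theta> stat_a stat_a
          - gig_cov ?\<theta> ln stat_a * gig_cov ?\<theta> stat_b stat_a)) / eff_det ?\<theta>"
    unfolding Gamma_eff_def fisher_information_def det_3 Gamma_eq[OF ab] eff_det_def
    by (simp add: power2_eq_square algebra_simps)
  also have "\<dots> = gig_cov ?\<theta> ln ln - eff_coeff_a ?\<theta> * gig_cov ?\<theta> ln stat_a
      - eff_coeff_b ?\<theta> * gig_cov ?\<theta> ln stat_b"
  proof -
    have "(x * D - y * u - z * v) / D = x - u / D * y - v / D * z" if "D > 0" for x y z u v D :: real
      using that by (simp add: field_simps)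
    from this[OF eff_det_pos[OF \<theta>]] show ?thesis
      unfolding eff_coeff_a_def eff_coeff_b_def .
  qed
  also have "\<dots> = gig_cov ?\<theta> (eff_score ?\<theta>) ln"
    using \<theta> by (simp add: eff_score_cov gig_cov_sym[of _ stat_a ln] gig_cov_sym[of _ stat_b ln])
  finally show ?thesis .
qed

lemma Gamma_eff_pos: "a > 0 \<Longrightarrow> b > 0 \<Longrightarrow> Gamma_eff p a b > 0"
  by (simp add: Gamma_eff_eq eff_score_cov_pos gig_params_iff)

text \<open>The displayed two-by-two matrix over the determinant is the inverse of the nuisance
  block, so multiplying it by the row of covariances with ln gives the regression
  coefficients.\<close>

lemma Delta_eff_eq:
  assumes ab: "a > 0" "b > 0"
  shows "Delta_eff n x p a b = Delta_p n x p a b - eff_coeff_a (p, a, b) * Delta_a n x p a b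
    - eff_coeff_b (p, a, b) * Delta_b n x p a b"
  unfolding Delta_eff_def Gamma_eq[OF ab] eff_coeff_a_def eff_coeff_b_def eff_det_def[symmetric]
  by (simp add: inner_vec_def sum_2 matrix_vector_mult_def algebra_simps diff_divide_distrib add_divide_distrib)

lemma Delta_eff_eq_sum:
  assumes ab: "a > 0" "b > 0"
  shows "Delta_eff n x p a b =
    (\<Sum>i<n. eff_score (p, a, b) (x i) - gig_E (p, a, b) (eff_score (p, a, b))) / sqrt (real n)"
proof -
  have \<theta>: "(p, a, b) \<in> gig_params" using ab by (simp add: gig_params_iff)
  have E: "gig_E (p, a, b) (eff_score (p, a, b)) = gig_E (p, a, b) ln
      - eff_coeff_a (p, a, b) * gig_E (p, a, b) stat_a - eff_coeff_b (p, a, b) * gig_E (p, a, b) stat_b"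
    using \<theta> by (simp add: eff_score_def[abs_def] gig_E_diff gig_E_cmult)
  show ?thesis
    unfolding Delta_eff_eq[OF ab] Delta_eq[OF ab] E times_divide_eq_right sum_distrib_left
      diff_divide_distrib[symmetric] sum_subtractf[symmetric]
    by (intro arg_cong2[where f = "(/)"] sum.cong refl) (simp add: eff_score_def algebra_simps)
qed

section \<open>Limit theorems\<close>

lemma product_char_sum:
  fixes g :: "'a \<Rightarrow> real"
  assumes M: "prob_space M" and [measurable]: "g \<in> borel_measurable M"
  shows "char (distr (\<Pi>\<^sub>M i\<in>{..<n}. M) borel (\<lambda>x. (\<Sum>i<n. g (x i)) / c)) t
    = char (distr M borel g) (t / c) ^ n"
proof -
  interpret prob_space M by fact
  interpret product_sigma_finite "\<lambda>i::nat. M" ..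
  have "char (distr (\<Pi>\<^sub>M i\<in>{..<n}. M) borel (\<lambda>x. (\<Sum>i<n. g (x i)) / c)) t
      = (\<integral>x. (\<Prod>i<n. iexp (t / c * g (x i))) \<partial>(\<Pi>\<^sub>M i\<in>{..<n}. M))"
    unfolding char_def
    by (subst integral_distr) (auto simp: exp_sum[symmetric] sum_distrib_left sum_divide_distrib)
  also have "\<dots> = (\<Prod>i<n. \<integral>x. iexp (t / c * g x) \<partial>M)"
    by (intro product_integral_prod integrable_const_bound[where B = 1]) auto
  also have "\<dots> = char (distr M borel g) (t / c) ^ n"
    unfolding char_def by (subst integral_distr) auto
  finally show ?thesis .
qed

text \<open>Characteristic functions are compared with (1 - t^2 / (2 n))^n, and the bounded third
  moments make n times the one-factor error vanish. The variance only tends to 1, because in the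
  application it is scaled by its limit rather than by its value in row n.\<close>

theorem clt_triangular_array:
  fixes M :: "nat \<Rightarrow> 'a measure" and g :: "nat \<Rightarrow> 'a \<Rightarrow> real"
  assumes M: "\<And>n. prob_space (M n)"
    and g: "\<And>n. g n \<in> borel_measurable (M n)"
    and int1: "\<And>n. integrable (M n) (g n)"
    and int2: "\<And>n. integrable (M n) (\<lambda>x. (g n x)\<^sup>2)"
    and int3: "\<And>n. integrable (M n) (\<lambda>x. \<bar>g n x\<bar> ^ 3)"
    and mean: "\<And>n. (\<integral>x. g n x \<partial>M n) = 0"
    and var: "(\<lambda>n. \<integral>x. (g n x)\<^sup>2 \<partial>M n) \<longlonglongrightarrow> 1"
    and third: "\<And>n. (\<integral>x. \<bar>g n x\<bar> ^ 3 \<partial>M n) \<le> B"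
  shows "weak_conv_m (\<lambda>n. distr (\<Pi>\<^sub>M i\<in>{..<n}. M n) borel (\<lambda>x. (\<Sum>i<n. g n (x i)) / sqrt (real n)))
    std_normal_distribution"
proof (rule levy_continuity)
  note [measurable] = g
  show "real_distribution (distr (\<Pi>\<^sub>M i\<in>{..<n}. M n) borel (\<lambda>x. (\<Sum>i<n. g n (x i)) / sqrt (real n)))" for n
    by (intro prob_space.real_distribution_distr prob_space_PiM M) measurable
  show "real_distribution std_normal_distribution" by (rule real_dist_normal_dist)
  fix t :: real
  define v where "v n = (\<integral>x. (g n x)\<^sup>2 \<partial>M n)" for n
  define \<psi> where "\<psi> n = char (distr (M n) borel (g n)) (t / sqrt (real n))" for n
  \<comment> \<open>The first term is n times the third-order Taylor error, the second is n times
    the effect of a row variance different from 1.\<close>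
  define r where "r n = \<bar>t\<bar> ^ 3 * B / 6 / sqrt (real n) + t\<^sup>2 / 2 * \<bar>v n - 1\<bar>" for n
  \<comment> \<open>The condition n \<ge> t^2 / 4 keeps 1 - t^2 / (2 n) within [-1, 1]; the
    comparison of n-th powers needs both bases of modulus at most 1.\<close>
  have bound: "cmod (\<psi> n ^ n - of_real ((1 + (- (t\<^sup>2) / 2) / n) ^ n)) \<le> r n"
    if n: "n \<ge> 1" "real n \<ge> t\<^sup>2 / 4" for n
  proof -
    interpret prob_space "M n" by (rule M)
    let ?t = "t / sqrt (real n)"
    have t2: "?t\<^sup>2 = t\<^sup>2 / n" by (simp add: power_divide)
    have "cmod (\<psi> n - (1 - ?t\<^sup>2 * v n / 2))
        \<le> (?t\<^sup>2 / 6) * expectation (\<lambda>x. min (6 * (g n x)\<^sup>2) (\<bar>?t\<bar> * \<bar>g n x\<bar> ^ 3))"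
      unfolding \<psi>_def
      by (rule char_approx3'[OF _ int1 int2]) (auto simp: mean v_def)
    also have "\<dots> \<le> (?t\<^sup>2 / 6) * expectation (\<lambda>x. \<bar>?t\<bar> * \<bar>g n x\<bar> ^ 3)"
      by (intro mult_left_mono integral_mono integrable_min integrable_mult_right int2 int3) auto
    also have "\<dots> \<le> (?t\<^sup>2 / 6) * (\<bar>?t\<bar> * B)"
      using third by (auto intro!: mult_left_mono divide_right_mono)
    finally have 1: "cmod (\<psi> n - of_real (1 - ?t\<^sup>2 * v n / 2)) \<le> (?t\<^sup>2 / 6) * (\<bar>?t\<bar> * B)"
      by simp
    have 2: "cmod (of_real (1 - ?t\<^sup>2 * v n / 2) - of_real (1 + (- (t\<^sup>2) / 2) / n)) = t\<^sup>2 / 2 * \<bar>v n - 1\<bar> / n"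
    proof -
      have "(1 - ?t\<^sup>2 * v n / 2) - (1 + (- (t\<^sup>2) / 2) / n) = - (t\<^sup>2 / 2 * (v n - 1) / n)"
        unfolding t2 using n by (simp add: field_simps)
      then show ?thesis
        unfolding of_real_diff[symmetric] norm_of_real by (simp add: abs_mult)
    qed
    have 3: "cmod (\<psi> n - of_real (1 + (- (t\<^sup>2) / 2) / n))
        \<le> (?t\<^sup>2 / 6) * (\<bar>?t\<bar> * B) + t\<^sup>2 / 2 * \<bar>v n - 1\<bar> / n"
      by (rule norm_diff_triangle_le[OF 1 eq_refl[OF 2]])
    have "cmod (\<psi> n ^ n - of_real (1 + (- (t\<^sup>2) / 2) / n) ^ n)
        \<le> n * cmod (\<psi> n - of_real (1 + (- (t\<^sup>2) / 2) / n))"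
    proof (rule norm_power_diff)
      show "cmod (\<psi> n) \<le> 1"
        unfolding \<psi>_def by (intro real_distribution.cmod_char_le_1 real_distribution_distr g)
      have "\<bar>1 + (- (t\<^sup>2) / 2) / n\<bar> \<le> 1"
        using n by (auto intro!: abs_leI simp: divide_le_eq)
      then show "cmod (of_real (1 + (- (t\<^sup>2) / 2) / n)) \<le> 1"
        unfolding norm_of_real .
    qed
    also have "\<dots> \<le> n * ((?t\<^sup>2 / 6) * (\<bar>?t\<bar> * B) + t\<^sup>2 / 2 * \<bar>v n - 1\<bar> / n)"
      using 3 by (intro mult_left_mono) auto
    also have "\<dots> = r n"
      unfolding t2 r_def using n by (simp add: field_simps power3_eq_cube power2_eq_square)
    finally show ?thesis by simp
  qed
  have v: "v \<longlonglongrightarrow> 1" using var by (simp add: v_def[abs_def])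
  have "r \<longlonglongrightarrow> 0 + t\<^sup>2 / 2 * \<bar>1 - 1\<bar>"
    unfolding r_def
    by (intro tendsto_intros v tendsto_divide_0[OF tendsto_const] filterlim_at_top_imp_at_infinity
        filterlim_compose[OF sqrt_at_top filterlim_real_sequentially])
  then have r: "r \<longlonglongrightarrow> 0" by simp
  have "\<forall>\<^sub>F n in sequentially. n \<ge> 1 \<and> real n \<ge> t\<^sup>2 / 4"
    using filterlim_real_sequentially
    by (intro eventually_conj eventually_ge_at_top) (auto simp only: filterlim_at_top)
  then have "\<forall>\<^sub>F n in sequentially. cmod (\<psi> n ^ n - of_real ((1 + (- (t\<^sup>2) / 2) / n) ^ n)) \<le> r n"
    by eventually_elim (rule bound, auto)
  then have "(\<lambda>n. \<psi> n ^ n - of_real ((1 + (- (t\<^sup>2) / 2) / n) ^ n)) \<longlonglongrightarrow> 0"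
    by (rule Lim_null_comparison[OF _ r])
  moreover have "(\<lambda>n. complex_of_real ((1 + (- (t\<^sup>2) / 2) / n) ^ n)) \<longlonglongrightarrow> of_real (exp (- (t\<^sup>2) / 2))"
    by (rule isCont_tendsto_compose[OF _ tendsto_exp_limit_sequentially]) auto
  ultimately have "(\<lambda>n. \<psi> n ^ n) \<longlonglongrightarrow> of_real (exp (- (t\<^sup>2) / 2))"
    by (rule Lim_transform[rotated])
  then show "(\<lambda>n. char (distr (\<Pi>\<^sub>M i\<in>{..<n}. M n) borel (\<lambda>x. (\<Sum>i<n. g n (x i)) / sqrt (real n))) t)
      \<longlonglongrightarrow> char std_normal_distribution t"
    by (simp add: product_char_sum[OF M g] \<psi>_def char_std_normal_distribution)
qed

section \<open>Contiguity of product measures and tools for convergence in distribution\<close>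

lemma PiM_density:
  assumes I: "finite I" and M: "prob_space M" and f[measurable]: "f \<in> borel_measurable M"
    and D: "prob_space (density M f)"
  shows "(\<Pi>\<^sub>M i\<in>I. density M f) = density (\<Pi>\<^sub>M i\<in>I. M) (\<lambda>x. \<Prod>i\<in>I. f (x i))"
proof -
  interpret M: prob_space M by fact
  interpret D: prob_space "density M f" by fact
  interpret PM: product_sigma_finite "\<lambda>_. M" ..
  interpret PD: product_sigma_finite "\<lambda>_. density M f" ..
  show ?thesis
  proof (rule PD.PiM_eqI[OF I, symmetric])
    show "sets (density (\<Pi>\<^sub>M i\<in>I. M) (\<lambda>x. \<Prod>i\<in>I. f (x i))) = sets (\<Pi>\<^sub>M i\<in>I. density M f)"
      by (simp cong: sets_PiM_cong)
    fix A assume A: "\<And>i. i \<in> I \<Longrightarrow> A i \<in> sets (density M f)"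
    then have [measurable]: "i \<in> I \<Longrightarrow> A i \<in> sets M" for i by simp
    have "Pi\<^sub>E I A \<in> sets (\<Pi>\<^sub>M i\<in>I. M)"
      using I A by (intro sets_PiM_I_finite) auto
    then have "emeasure (density (\<Pi>\<^sub>M i\<in>I. M) (\<lambda>x. \<Prod>i\<in>I. f (x i))) (Pi\<^sub>E I A)
        = (\<integral>\<^sup>+x. (\<Prod>i\<in>I. f (x i)) * indicator (Pi\<^sub>E I A) x \<partial>(\<Pi>\<^sub>M i\<in>I. M))"
      by (intro emeasure_density) auto
    also have "\<dots> = (\<integral>\<^sup>+x. (\<Prod>i\<in>I. f (x i) * indicator (A i) (x i)) \<partial>(\<Pi>\<^sub>M i\<in>I. M))"
    proof (intro nn_integral_cong)
      fix x assume "x \<in> space (\<Pi>\<^sub>M i\<in>I. M)"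
      \<comment> \<open>Points of the product space are extensional, so membership in the box is
        decided by the coordinates in I alone. The integrand therefore factorises.\<close>
      then have "indicator (Pi\<^sub>E I A) x = (\<Prod>i\<in>I. indicator (A i) (x i) :: ennreal)"
        using I by (auto simp: indicator_def space_PiM PiE_iff prod_zero_iff split: if_splits)
      then show "(\<Prod>i\<in>I. f (x i)) * indicator (Pi\<^sub>E I A) x = (\<Prod>i\<in>I. f (x i) * indicator (A i) (x i))"
        by (simp add: prod.distrib)
    qed
    also have "\<dots> = (\<Prod>i\<in>I. \<integral>\<^sup>+x. f x * indicator (A i) x \<partial>M)"
      by (intro PM.product_nn_integral_prod I) auto
    also have "\<dots> = (\<Prod>i\<in>I. emeasure (density M f) (A i))"
      by (intro prod.cong refl emeasure_density[symmetric]) auto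
    finally show "emeasure (density (\<Pi>\<^sub>M i\<in>I. M) (\<lambda>x. \<Prod>i\<in>I. f (x i))) (Pi\<^sub>E I A)
        = (\<Prod>i\<in>I. emeasure (density M f) (A i))" .
  qed
qed

text \<open>For the product likelihood ratio L the elementary bound L \<le> \<eta> L^2 + 1 / \<eta>
  gives Q(A) \<le> \<eta> E L^2 + P(A) / \<eta>. By independence E L^2 is the n-th power of the
  one-observation moment and hence bounded, so \<eta> is chosen first and n afterwards.\<close>

lemma contiguity_if_bounded_second_moment:
  fixes f :: "nat \<Rightarrow> 'a \<Rightarrow> real"
  assumes M: "prob_space M"
    and f[measurable]: "\<And>n. f n \<in> borel_measurable M" and f_nonneg: "\<And>n x. f n x \<ge> 0"
    and D: "\<And>n. prob_space (density M (f n))"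
    and int1: "\<And>n. integrable M (f n)" and int2: "\<And>n. integrable M (\<lambda>x. (f n x)\<^sup>2)"
    and bound: "\<forall>\<^sub>F n in sequentially. (\<integral>x. (f n x)\<^sup>2 \<partial>M) ^ n \<le> K"
    and K: "K \<ge> 0"
    and A: "\<And>n. A n \<in> sets (\<Pi>\<^sub>M i\<in>{..<n}. M)"
    and lim: "(\<lambda>n. measure (\<Pi>\<^sub>M i\<in>{..<n}. M) (A n)) \<longlonglongrightarrow> 0"
  shows "(\<lambda>n. measure (\<Pi>\<^sub>M i\<in>{..<n}. density M (f n)) (A n)) \<longlonglongrightarrow> 0"
proof -
  interpret M: prob_space M by fact
  interpret PM: product_sigma_finite "\<lambda>_::nat. M" ..
  have le: "measure (\<Pi>\<^sub>M i\<in>{..<n}. density M (f n)) (A n)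
      \<le> \<eta> * K + measure (\<Pi>\<^sub>M i\<in>{..<n}. M) (A n) / \<eta>"
    if \<eta>: "\<eta> > 0" and bound_n: "(\<integral>x. (f n x)\<^sup>2 \<partial>M) ^ n \<le> K" for n \<eta>
  proof -
    let ?P = "\<Pi>\<^sub>M i\<in>{..<n}. M"
    interpret P: prob_space ?P by (intro prob_space_PiM M)
    define L where "L x = (\<Prod>i<n. f n (x i))" for x
    have L[measurable]: "L \<in> borel_measurable ?P" unfolding L_def by measurable
    have L0: "L x \<ge> 0" for x unfolding L_def by (intro prod_nonneg) (auto simp: f_nonneg)
    have "(\<Pi>\<^sub>M i\<in>{..<n}. density M (f n)) = density ?P (\<lambda>x. \<Prod>i<n. ennreal (f n (x i)))"
      by (intro PiM_density M D) auto
    also have "\<dots> = density ?P (\<lambda>x. ennreal (L x))"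
      unfolding L_def by (intro density_cong) (auto simp: prod_ennreal f_nonneg)
    finally have eq: "(\<Pi>\<^sub>M i\<in>{..<n}. density M (f n)) = density ?P (\<lambda>x. ennreal (L x))" .
    have iL: "integrable ?P L" unfolding L_def by (intro PM.product_integrable_prod int1) auto
    have iL2: "integrable ?P (\<lambda>x. (L x)\<^sup>2)" "(\<integral>x. (L x)\<^sup>2 \<partial>?P) = (\<integral>x. (f n x)\<^sup>2 \<partial>M) ^ n"
      unfolding L_def prod_power_distrib
      using PM.product_integrable_prod[of "{..<n}" "\<lambda>_ x. (f n x)\<^sup>2"] 
        PM.product_integral_prod[of "{..<n}" "\<lambda>_ x. (f n x)\<^sup>2"] int2 by auto
    have iA: "integrable ?P (\<lambda>x. L x * indicator (A n) x)"
      by (intro integrable_real_mult_indicator A iL)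
    have iA': "integrable ?P (\<lambda>x. indicator (A n) x :: real)"
      using A by (intro P.integrable_const_bound[of _ 1]) auto
    have "emeasure (density ?P (\<lambda>x. ennreal (L x))) (A n) = (\<integral>\<^sup>+x. ennreal (L x * indicator (A n) x) \<partial>?P)"
      using A L0 by (subst emeasure_density) (auto simp: ennreal_mult' ennreal_indicator)
    also have "\<dots> = ennreal (\<integral>x. L x * indicator (A n) x \<partial>?P)"
      using L0 by (intro nn_integral_eq_integral iA) auto
    finally have "measure (\<Pi>\<^sub>M i\<in>{..<n}. density M (f n)) (A n) = (\<integral>x. L x * indicator (A n) x \<partial>?P)"
      unfolding eq measure_def using L0 by (simp add: Bochner_Integration.integral_nonneg)
    also have "\<dots> \<le> (\<integral>x. \<eta> * (L x)\<^sup>2 + indicator (A n) x / \<eta> \<partial>?P)"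
    proof (intro integral_mono iA Bochner_Integration.integrable_add integrable_mult_right iL2
        integrable_divide_zero iA')
      fix x
      \<comment> \<open>Expanding the square gives 2 L \<le> \<eta> L^2 + 1 / \<eta>, of which half
        suffices because L is nonnegative.\<close>
      have "0 \<le> (\<eta> * L x - 1)\<^sup>2 / \<eta>" "0 \<le> \<eta> * L x" using \<eta> L0 by auto
      then have "L x \<le> \<eta> * (L x)\<^sup>2 + 1 / \<eta>"
        using \<eta> by (simp add: power2_eq_square field_simps)
      then show "L x * indicator (A n) x \<le> \<eta> * (L x)\<^sup>2 + indicator (A n) x / \<eta>"
        using \<eta> by (auto simp: indicator_def)
    qed
    also have "\<dots> = \<eta> * (\<integral>x. (f n x)\<^sup>2 \<partial>M) ^ n + measure ?P (A n) / \<eta>"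
      using A iA' iL2 sets.sets_into_space[OF A[of n]] by (simp add: Int_absorb1 Int_absorb2)
    also have "\<dots> \<le> \<eta> * K + measure ?P (A n) / \<eta>"
      using bound_n \<eta> by (intro add_right_mono mult_left_mono) auto
    finally show ?thesis .
  qed
  show ?thesis
  proof (rule tendstoI)
    fix e :: real assume e: "e > 0"
    \<comment> \<open>K + 1 instead of K avoids division by zero and makes \<eta> * K strictly less
      than e / 2.\<close>
    define \<eta> where "\<eta> = e / (2 * (K + 1))"
    have \<eta>: "\<eta> > 0" "\<eta> * K < e / 2" using e K by (auto simp: \<eta>_def field_simps)
    have "\<forall>\<^sub>F n in sequentially. measure (\<Pi>\<^sub>M i\<in>{..<n}. M) (A n) < \<eta> * (e / 2)"
      using lim \<eta>(1) e by (intro order_tendstoD(2)) auto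
    with bound show "\<forall>\<^sub>F n in sequentially. dist (measure (\<Pi>\<^sub>M i\<in>{..<n}. density M (f n)) (A n)) 0 < e"
    proof eventually_elim
      case (elim n)
      then have "measure (\<Pi>\<^sub>M i\<in>{..<n}. M) (A n) / \<eta> < e / 2" using \<eta>(1) by (simp add: field_simps)
      with le[OF \<eta>(1) elim(1)] \<eta>(2)
      have "measure (\<Pi>\<^sub>M i\<in>{..<n}. density M (f n)) (A n) < e" by linarith
      then show ?case by simp
    qed
  qed
qed

text \<open>The event for Q is squeezed between events for W with thresholds moved by \<delta>.
  Continuity of F gives the strict and the weak inequality the same limit. Measurability of Q is
  asked only eventually, since the estimators are constrained only for n \<ge> 1.\<close>

lemma slutsky_cdf:
  fixes N :: "nat \<Rightarrow> 'a measure" and W Q :: "nat \<Rightarrow> 'a \<Rightarrow> real"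
  assumes N: "\<And>n. prob_space (N n)"
    and W: "\<And>n. W n \<in> borel_measurable (N n)"
    and Q: "\<forall>\<^sub>F n in sequentially. Q n \<in> borel_measurable (N n)"
    and lim: "\<And>w. (\<lambda>n. \<P>(x in N n. W n x \<le> w)) \<longlonglongrightarrow> F w"
    and F: "\<And>w. isCont F w"
    and diff: "\<And>e. e > 0 \<Longrightarrow> (\<lambda>n. \<P>(x in N n. \<bar>Q n x - W n x - d\<bar> > e)) \<longlonglongrightarrow> 0"
  shows "(\<lambda>n. \<P>(x in N n. Q n x \<le> z)) \<longlonglongrightarrow> F (z - d)"
    and "(\<lambda>n. \<P>(x in N n. Q n x < z)) \<longlonglongrightarrow> F (z - d)"
proof -
  have "\<forall>\<^sub>F n in sequentially. \<bar>\<P>(x in N n. Q n x \<le> z) - F (z - d)\<bar> < e \<and>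
      \<bar>\<P>(x in N n. Q n x < z) - F (z - d)\<bar> < e" if e: "e > 0" for e
  proof -
    obtain \<delta> where \<delta>: "\<delta> > 0" "\<And>w. \<bar>w - (z - d)\<bar> \<le> \<delta> \<Longrightarrow> \<bar>F w - F (z - d)\<bar> < e / 3"
    proof -
      have "\<forall>\<^sub>F w in at (z - d). dist (F w) (F (z - d)) < e / 3"
        using F[of "z - d"] e by (intro tendstoD) (auto simp: isCont_def)
      then obtain \<delta> where "\<delta> > 0" "\<And>w. w \<noteq> z - d \<Longrightarrow> dist w (z - d) < \<delta> \<Longrightarrow> dist (F w) (F (z - d)) < e / 3"
        by (auto simp: eventually_at)
      then have "\<bar>F w - F (z - d)\<bar> < e / 3" if "\<bar>w - (z - d)\<bar> \<le> \<delta> / 2" for w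
        using that e by (cases "w = z - d") (auto simp: dist_real_def)
      then show ?thesis using that[of "\<delta> / 2"] \<open>\<delta> > 0\<close> by auto
    qed
    have up: "\<forall>\<^sub>F n in sequentially. \<P>(x in N n. W n x \<le> z - d + \<delta>) < F (z - d) + 2 * e / 3"
    proof (rule order_tendstoD(2)[OF lim])
      have "\<bar>F (z - d + \<delta>) - F (z - d)\<bar> < e / 3" using \<delta>(1) by (intro \<delta>(2)) auto
      then show "F (z - d + \<delta>) < F (z - d) + 2 * e / 3" using e by linarith
    qed
    have lo: "\<forall>\<^sub>F n in sequentially. \<P>(x in N n. W n x \<le> z - d - \<delta>) > F (z - d) - 2 * e / 3"
    proof (rule order_tendstoD(1)[OF lim])
      have "\<bar>F (z - d - \<delta>) - F (z - d)\<bar> < e / 3" using \<delta>(1) by (intro \<delta>(2)) auto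
      then show "F (z - d - \<delta>) > F (z - d) - 2 * e / 3" using e by linarith
    qed
    \<comment> \<open>The tolerance is half the threshold shift, which leaves room for the strict
      inequality Q < z in the lower bound.\<close>
    have df: "\<forall>\<^sub>F n in sequentially. \<P>(x in N n. \<bar>Q n x - W n x - d\<bar> > \<delta> / 2) < e / 3"
      using e \<delta>(1) by (intro order_tendstoD(2)[OF diff]) auto
    from up lo df Q show ?thesis
    proof eventually_elim
      case (elim n)
      interpret prob_space "N n" by (rule N)
      note [measurable] = W elim(4)
      have 1: "prob {x \<in> space (N n). Q n x \<le> z} \<le> prob ({x \<in> space (N n). W n x \<le> z - d + \<delta>}
          \<union> {x \<in> space (N n). \<bar>Q n x - W n x - d\<bar> > \<delta> / 2})"
        using \<delta>(1) by (intro finite_measure_mono) (auto simp: abs_if split: if_splits)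
      also have "\<dots> \<le> prob {x \<in> space (N n). W n x \<le> z - d + \<delta>}
          + prob {x \<in> space (N n). \<bar>Q n x - W n x - d\<bar> > \<delta> / 2}"
        by (intro measure_Un_le) auto
      finally have 1: "prob {x \<in> space (N n). Q n x \<le> z} < F (z - d) + e" using elim by simp
      have "prob {x \<in> space (N n). W n x \<le> z - d - \<delta>} \<le> prob ({x \<in> space (N n). Q n x < z}
          \<union> {x \<in> space (N n). \<bar>Q n x - W n x - d\<bar> > \<delta> / 2})"
        using \<delta>(1) by (intro finite_measure_mono) (auto simp: abs_if split: if_splits)
      also have "\<dots> \<le> prob {x \<in> space (N n). Q n x < z}
          + prob {x \<in> space (N n). \<bar>Q n x - W n x - d\<bar> > \<delta> / 2}"
        by (intro measure_Un_le) auto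
      finally have 2: "prob {x \<in> space (N n). Q n x < z} > F (z - d) - e" using elim by simp
      have "prob {x \<in> space (N n). Q n x < z} \<le> prob {x \<in> space (N n). Q n x \<le> z}"
        by (intro finite_measure_mono) auto
      with 1 2 show ?case by auto
    qed
  qed
  note * = this
  show "(\<lambda>n. \<P>(x in N n. Q n x \<le> z)) \<longlonglongrightarrow> F (z - d)" "(\<lambda>n. \<P>(x in N n. Q n x < z)) \<longlonglongrightarrow> F (z - d)"
    by (intro tendstoI; drule *; auto elim!: eventually_mono simp: dist_real_def)+
qed

text \<open>Choosing an offending point whenever one exists turns convergence along every sequence
  in K into uniform smallness on K. This lets a deterministic limit be applied to random
  arguments.\<close>

lemma eventually_uniformly_small:
  fixes D :: "nat \<Rightarrow> 'a \<Rightarrow> real"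
  assumes lim: "\<And>s. (\<And>n. s n \<in> K) \<Longrightarrow> (\<lambda>n. D n (s n)) \<longlonglongrightarrow> 0" and e: "e > 0"
  shows "\<forall>\<^sub>F n in sequentially. \<forall>s\<in>K. \<bar>D n s\<bar> \<le> e"
proof (cases "K = {}")
  case False
  then obtain s0 where s0: "s0 \<in> K" by auto
  define s where "s n = (if \<exists>s\<in>K. \<bar>D n s\<bar> > e then SOME s. s \<in> K \<and> \<bar>D n s\<bar> > e else s0)" for n
  have s: "s n \<in> K \<and> (\<bar>D n (s n)\<bar> \<le> e \<longrightarrow> (\<forall>s\<in>K. \<bar>D n s\<bar> \<le> e))" for n
  proof (cases "\<exists>s\<in>K. \<bar>D n s\<bar> > e")
    case True
    then have "s n \<in> K \<and> \<bar>D n (s n)\<bar> > e"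
      unfolding s_def using someI_ex[of "\<lambda>s. s \<in> K \<and> \<bar>D n s\<bar> > e"] by auto
    then show ?thesis by auto
  qed (use s0 in \<open>auto simp: s_def not_less\<close>)
  then have "(\<lambda>n. D n (s n)) \<longlonglongrightarrow> 0" by (intro lim) auto
  then have "\<forall>\<^sub>F n in sequentially. dist (D n (s n)) 0 < e" by (rule tendstoD[OF _ e])
  then show ?thesis
    by eventually_elim (use s in auto)
qed auto

section \<open>The standard normal distribution function\<close>

interpretation std_normal: real_distribution std_normal_distribution
  by (rule real_dist_normal_dist)

lemma std_normal_null_singleton: "measure std_normal_distribution {x} = 0"
proof -
  have "emeasure std_normal_distribution {x} = (\<integral>\<^sup>+y. ennreal (std_normal_density y) * indicator {x} y \<partial>lborel)"
    by (intro emeasure_density) auto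
  also have "\<dots> = 0"
    by (subst nn_integral_indicator_singleton) auto
  finally show ?thesis by (simp add: measure_def)
qed

lemma isCont_Phi: "isCont Phi x"
  unfolding Phi_def by (simp add: std_normal.isCont_cdf std_normal_null_singleton)

lemma Phi_strict_mono: "strict_mono Phi"
proof (rule strict_monoI)
  fix x y :: real assume xy: "x < y"
  have "Phi y - Phi x = measure std_normal_distribution {x<..y}"
    unfolding Phi_def by (rule std_normal.cdf_diff_eq[OF xy])
  moreover have "measure std_normal_distribution {x<..y} \<noteq> 0"
  proof
    assume "measure std_normal_distribution {x<..y} = 0"
    then have "emeasure std_normal_distribution {x<..y} = 0"
      by (simp add: std_normal.emeasure_eq_measure)
    then have "{x<..y} \<in> null_sets std_normal_distribution" by (auto simp: null_sets_def)
    then have ae: "AE z in lborel. z \<in> {x<..y} \<longrightarrow> ennreal (std_normal_density z) = 0"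
      by (subst (asm) null_sets_density_iff) auto
    have pos: "\<not> std_normal_density z \<le> 0" for z
      using normal_density_pos[of 1 0 z] by simp
    from ae have "AE z in lborel. z \<notin> {x<..y}"
      by eventually_elim (auto simp: ennreal_eq_0_iff pos)
    then have "emeasure lborel {x<..y} = 0"
      using AE_iff_null_sets[of "{x<..y}" lborel] by (auto simp: null_sets_def)
    then show False using xy by simp
  qed
  ultimately show "Phi x < Phi y"
    using measure_nonneg[of std_normal_distribution "{x<..y}"] by linarith
qed

text \<open>The density is even and single points are null, so the two closed half-lines carry equal
  mass with total 1.\<close>

lemma Phi_0: "Phi 0 = 1 / 2"
proof -
  let ?D = std_normal_distribution
  have "emeasure ?D {..0} = (\<integral>\<^sup>+y. ennreal (std_normal_density y) * indicator {..0} y \<partial>lborel)"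
    by (intro emeasure_density) auto
  also have "\<dots> = (\<integral>\<^sup>+y. ennreal (std_normal_density y) * indicator {0..} y \<partial>lborel)"
    by (subst nn_integral_real_affine[where c = "-1" and t = 0])
       (auto intro!: nn_integral_cong simp: normal_density_def indicator_def)
  also have "\<dots> = emeasure ?D {0..}"
    by (intro emeasure_density[symmetric]) auto
  finally have eq: "measure ?D {..0} = measure ?D {0..}" by (simp add: measure_def)
  have "1 = measure ?D ({..0} \<union> {0..})"
  proof -
    have "{..0} \<union> {0..} = (UNIV :: real set)" by auto
    then show ?thesis using std_normal.prob_space by simp
  qed
  also have "{..0} \<union> {0..} = {..0} \<union> ({0..} - {0::real})" by auto
  also have "measure ?D \<dots> = measure ?D {..0} + measure ?D ({0..} - {0})"
    by (intro std_normal.finite_measure_Union) auto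
  also have "measure ?D ({0..} - {0}) = measure ?D {0..}"
    by (subst std_normal.finite_measure_Diff) (auto simp: std_normal_null_singleton)
  finally show ?thesis unfolding Phi_def cdf_def using eq by simp
qed

text \<open>Existence follows from the limits of the distribution function and the intermediate
  value theorem, uniqueness from strict monotonicity; together they justify the definite
  description.\<close>

lemma Phi_upper_quantile:
  assumes "0 < \<beta>" "\<beta> < 1"
  shows "Phi (upper_quantile \<beta>) = 1 - \<beta>"
proof -
  have "\<forall>\<^sub>F x in at_bot. Phi x < 1 - \<beta>"
    unfolding Phi_def using assms by (intro order_tendstoD(2)[OF std_normal.cdf_lim_at_bot]) auto
  then obtain x where x: "Phi x < 1 - \<beta>" by (auto simp: eventually_at_bot_linorder)
  have "\<forall>\<^sub>F x in at_top. Phi x > 1 - \<beta>"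
    unfolding Phi_def using assms by (intro order_tendstoD(1)[OF std_normal.cdf_lim_at_top_prob]) auto
  then obtain y where y: "Phi y > 1 - \<beta>" by (auto simp: eventually_at_top_linorder)
  have "x \<le> y" using x y strict_mono_less[OF Phi_strict_mono, of x y] by linarith
  then obtain z where z: "Phi z = 1 - \<beta>"
    using IVT[of Phi x "1 - \<beta>" y] x y isCont_Phi by force
  then have "\<exists>!z. Phi z = 1 - \<beta>"
    using strict_mono_eq[OF Phi_strict_mono] by metis
  then show ?thesis unfolding upper_quantile_def by (rule theI')
qed

text \<open>Needed at \<alpha> / 2: a positive critical value makes the two tails of the two-sided
  test disjoint.\<close>

lemma upper_quantile_pos:
  assumes "0 < \<beta>" "\<beta> < 1 / 2"
  shows "upper_quantile \<beta> > 0"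
  using Phi_upper_quantile[of \<beta>] Phi_0 assms strict_mono_less[OF Phi_strict_mono, of 0 "upper_quantile \<beta>"]
  by auto

section \<open>Samples from the generalized inverse Gaussian law\<close>

lemma gig_density_eq:
  assumes ab: "a > 0" "b > 0" and x: "x > 0"
  shows "gig_density p a b x = exp ((p, a, b) \<bullet> gig_stat x) / x / gig_norm (p, a, b)"
proof -
  have "exp ((p, a, b) \<bullet> gig_stat x) / x = x powr (p - 1) * exp (- (a * x + b / x) / 2)"
  proof -
    have "(p, a, b) \<bullet> gig_stat x = p * ln x + - (a * x + b / x) / 2"
      using x by (simp add: inner_gig_stat field_simps)
    then show ?thesis
      using x by (simp only: exp_add) (simp add: powr_def left_diff_distrib exp_diff)
  qed
  moreover have "(a / b) powr (p / 2) = 1 / (b / a) powr (p / 2)"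
    using ab by (simp add: powr_divide)
  ultimately show ?thesis
    unfolding gig_density_def gig_norm_eq_besselK[OF ab] by simp
qed

lemma sets_gig [simp, measurable_cong]: "sets (gig p a b) = sets half_line"
  and space_gig [simp]: "space (gig p a b) = {0<..}"
  by (simp_all add: gig_def space_restrict_space)

lemma gig_eq_density:
  assumes ab: "a > 0" "b > 0"
  shows "gig p a b = density half_line (\<lambda>x. ennreal (exp ((p, a, b) \<bullet> gig_stat x) / x / gig_norm (p, a, b)))"
  unfolding gig_def
proof (rule density_cong)
  show "(\<lambda>x. ennreal (gig_density p a b x)) \<in> borel_measurable half_line"
    unfolding gig_density_def by (intro measurable_restrict_space1) measurable
  have "tame (\<lambda>x. (p, a, b) \<bullet> gig_stat x)" by simp
  note [measurable] = tame_measurable[OF this]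
  show "(\<lambda>x. ennreal (exp ((p, a, b) \<bullet> gig_stat x) / x / gig_norm (p, a, b))) \<in> borel_measurable half_line"
    by (intro measurable_restrict_space1) measurable
  show "AE x in half_line. ennreal (gig_density p a b x)
      = ennreal (exp ((p, a, b) \<bullet> gig_stat x) / x / gig_norm (p, a, b))"
    by (intro AE_I2) (simp add: gig_density_eq ab space_restrict_space)
qed

lemma measurable_gig: "f \<in> borel_measurable borel \<Longrightarrow> f \<in> borel_measurable (gig p a b)"
  by (subst measurable_cong_sets[OF sets_gig refl]) (rule measurable_half_line)

lemma tame_measurable_gig: "tame f \<Longrightarrow> f \<in> borel_measurable (gig p a b)"
  by (intro measurable_gig tame_measurable)

lemma
  assumes ab: "a > 0" "b > 0" and f: "tame f"
  shows integrable_gig: "integrable (gig p a b) f"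
    and integral_gig: "(\<integral>x. f x \<partial>gig p a b) = gig_E (p, a, b) f"
proof -
  let ?g = "\<lambda>x. exp ((p, a, b) \<bullet> gig_stat x) / x / gig_norm (p, a, b)"
  have \<theta>: "(p, a, b) \<in> gig_params" using ab by (simp add: gig_params_iff)
  have "tame (\<lambda>x. (p, a, b) \<bullet> gig_stat x)" by simp
  note [measurable] = tame_measurable[OF this]
  have g: "?g \<in> borel_measurable half_line" by (intro measurable_restrict_space1) measurable
  have g0: "AE x in half_line. 0 \<le> ?g x"
    using gig_norm_pos[OF \<theta>] by (intro AE_I2) (simp add: space_restrict_space)
  have f': "f \<in> borel_measurable half_line" by (intro measurable_half_line tame_measurable f)
  have eq: "?g x *\<^sub>R f x = (f x * exp ((p, a, b) \<bullet> gig_stat x) / x) / gig_norm (p, a, b)" for x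
    by simp
  show "integrable (gig p a b) f"
    unfolding gig_eq_density[OF ab] integrable_density[OF f' g g0] eq
    by (intro integrable_divide_zero gig_integrable f \<theta>)
  show "(\<integral>x. f x \<partial>gig p a b) = gig_E (p, a, b) f"
    unfolding gig_eq_density[OF ab] integral_density[OF f' g g0] eq
    by (simp only: integral_divide_zero gig_E_def gig_int_def[of f])
qed

lemma prob_space_gig:
  assumes ab: "a > 0" "b > 0"
  shows "prob_space (gig p a b)"
proof (rule prob_spaceI)
  have \<theta>: "(p, a, b) \<in> gig_params" using ab by (simp add: gig_params_iff)
  have i: "integrable (gig p a b) (\<lambda>x. 1 :: real)" by (rule integrable_gig[OF ab tame_const])
  have "emeasure (gig p a b) (space (gig p a b)) = (\<integral>\<^sup>+x. ennreal 1 \<partial>gig p a b)"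
    by simp
  also have "\<dots> = ennreal (\<integral>x. 1 \<partial>gig p a b)"
    by (rule nn_integral_eq_integral[OF i]) simp
  also have "\<dots> = 1"
    by (subst integral_gig[OF ab tame_const]) (simp add: \<theta>)
  finally show "emeasure (gig p a b) (space (gig p a b)) = 1" .
qed

section \<open>Laws of samples and their normal limits\<close>

lemma prob_space_sample_law: "a > 0 \<Longrightarrow> b > 0 \<Longrightarrow> prob_space (sample_law n p a b)"
  unfolding sample_law_def by (intro prob_space_PiM prob_space_gig)

lemma sets_sample_law: "sets (sample_law n p a b) = sets (positive_samples n)"
  unfolding sample_law_def positive_samples_def
  by (intro sets_PiM_cong refl) (simp add: sets_restrict_space)

lemma space_sample_law: "space (sample_law n p a b) = space (positive_samples n)"
  by (rule sets_eq_imp_space_eq[OF sets_sample_law])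

lemma measurable_sample_component:
  assumes "f \<in> borel_measurable borel" "i < n"
  shows "(\<lambda>x. f (x i)) \<in> borel_measurable (sample_law n p a b)"
  unfolding sample_law_def
  using measurable_compose[OF measurable_component_singleton[of i "{..<n}" "\<lambda>_. gig p a b"]
      measurable_gig[OF assms(1)]] assms(2) by simp

text \<open>The sums are centred at the mean under the current \<open>p n\<close> but scaled by the
  variance at the limit \<open>p0\<close>; continuity of the moments in p makes the row variances
  tend to 1.\<close>

lemma gig_clt:
  fixes p :: "nat \<Rightarrow> real"
  assumes ab: "a > 0" "b > 0" and p: "p \<longlonglongrightarrow> p0" and h: "tame h"
    and pos: "gig_cov (p0, a, b) h h > 0"
  shows "(\<lambda>n. \<P>(x in sample_law n (p n) a b.
      (\<Sum>i<n. h (x i) - gig_E (p n, a, b) h) / sqrt (real n) / sqrt (gig_cov (p0, a, b) h h) \<le> w))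
    \<longlonglongrightarrow> Phi w"
proof -
  define \<gamma> where "\<gamma> = gig_cov (p0, a, b) h h"
  define m where "m n = gig_E (p n, a, b) h" for n
  define g where "g n x = (h x - m n) / sqrt \<gamma>" for n x
  have \<gamma>: "\<gamma> > 0" using pos by (simp add: \<gamma>_def)
  have \<theta>: "(q, a, b) \<in> gig_params" for q using ab by (simp add: gig_params_iff)
  have lim: "(\<lambda>n. gig_E (p n, a, b) f) \<longlonglongrightarrow> gig_E (p0, a, b) f" if "tame f" for f
    by (rule continuous_on_tendsto_compose[OF gig_E_continuous_on[OF that]])
       (auto intro!: tendsto_intros p \<theta> always_eventually)
  have g_eq: "g n = (\<lambda>x. (1 / sqrt \<gamma>) * (h x - m n))" for n by (simp add: g_def fun_eq_iff)
  have tg: "tame (g n)" for n unfolding g_eq using h by (intro tame_cmult tame_diff) auto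
  \<comment> \<open>A common bound on the means gives one moderate function G dominating every row.
    Its third moments converge, hence are bounded.\<close>
  obtain M where M: "\<And>n. \<bar>m n\<bar> \<le> M"
    using convergentI[OF lim[OF h], THEN convergent_imp_Bseq] unfolding Bseq_def m_def by auto
  define G where "G x = (1 / sqrt \<gamma>) * (\<bar>h x\<bar> + M)" for x
  have G: "tame (\<lambda>x. G x ^ 3)" unfolding G_def using h by (intro tame_power tame_cmult tame_add) auto
  obtain B where B: "\<And>n. \<bar>gig_E (p n, a, b) (\<lambda>x. G x ^ 3)\<bar> \<le> B"
    using convergentI[OF lim[OF G], THEN convergent_imp_Bseq] unfolding Bseq_def by auto
  have "weak_conv_m (\<lambda>n. distr (\<Pi>\<^sub>M i\<in>{..<n}. gig (p n) a b) borel (\<lambda>x. (\<Sum>i<n. g n (x i)) / sqrt (real n)))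
    std_normal_distribution"
  proof (rule clt_triangular_array)
    show "(\<integral>x. \<bar>g n x\<bar> ^ 3 \<partial>gig (p n) a b) \<le> B" for n
    proof -
      have "gig_E (p n, a, b) (\<lambda>x. \<bar>g n x\<bar> ^ 3) \<le> gig_E (p n, a, b) (\<lambda>x. G x ^ 3)"
      proof (intro gig_E_mono G \<theta> tame_power tame_abs tg power_mono)
        fix x
        have "\<bar>h x - m n\<bar> \<le> \<bar>h x\<bar> + M" using M[of n] by linarith
        then show "\<bar>g n x\<bar> \<le> G x" using \<gamma> by (simp add: g_def G_def divide_right_mono)
      qed auto
      then show ?thesis
        using B[of n] tg by (subst integral_gig[OF ab]) (auto intro: tame_power tame_abs)
    qed
    show "(\<integral>x. g n x \<partial>gig (p n) a b) = 0" for n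
    proof -
      have "gig_E (p n, a, b) (g n) = 0"
        unfolding g_eq gig_E_cmult using h \<theta> by (simp add: gig_E_diff m_def)
      then show ?thesis using integral_gig[OF ab tg] by simp
    qed
    have var: "(\<integral>x. (g n x)\<^sup>2 \<partial>gig (p n) a b) = gig_cov (p n, a, b) h h / \<gamma>" for n
    proof -
      have "(\<lambda>x. (g n x)\<^sup>2) = (\<lambda>x. (1 / \<gamma>) * (h x - gig_E (p n, a, b) h)\<^sup>2)"
        using \<gamma> by (simp add: g_def fun_eq_iff power_divide m_def)
      then have "gig_E (p n, a, b) (\<lambda>x. (g n x)\<^sup>2) = 1 / \<gamma> * gig_cov (p n, a, b) h h"
        by (simp only: gig_E_cmult gig_cov_self[OF h \<theta>])
      then show ?thesis using tg by (subst integral_gig[OF ab]) (auto intro: tame_power)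
    qed
    have "(\<lambda>n. gig_cov (p n, a, b) h h / \<gamma>) \<longlonglongrightarrow> \<gamma> / \<gamma>"
      unfolding \<gamma>_def gig_cov_def using h by (intro tendsto_intros lim tame_mult) (use \<gamma> in \<open>auto simp: \<gamma>_def gig_cov_def\<close>)
    then show "(\<lambda>n. \<integral>x. (g n x)\<^sup>2 \<partial>gig (p n) a b) \<longlonglongrightarrow> 1"
      using \<gamma> by (simp add: var)
  qed (use tg in \<open>auto intro!: prob_space_gig integrable_gig ab tame_measurable_gig tame_power tame_abs\<close>)
  then have "(\<lambda>n. cdf (distr (sample_law n (p n) a b) borel (\<lambda>x. (\<Sum>i<n. g n (x i)) / sqrt (real n))) w) \<longlonglongrightarrow> Phi w"
    unfolding weak_conv_m_def weak_conv_def sample_law_def Phi_def[symmetric] using isCont_Phi by blast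
  moreover have "cdf (distr (sample_law n (p n) a b) borel (\<lambda>x. (\<Sum>i<n. g n (x i)) / sqrt (real n))) w
      = \<P>(x in sample_law n (p n) a b. (\<Sum>i<n. h (x i) - m n) / sqrt (real n) / sqrt \<gamma> \<le> w)" for n
  proof -
    have "(\<lambda>x. (\<Sum>i<n. g n (x i)) / sqrt (real n)) \<in> borel_measurable (sample_law n (p n) a b)"
      by (intro borel_measurable_divide borel_measurable_sum borel_measurable_const measurable_sample_component
          tame_measurable tg) auto
    moreover have "(\<Sum>i<n. g n (x i)) / sqrt (real n) = (\<Sum>i<n. h (x i) - m n) / sqrt (real n) / sqrt \<gamma>" for x
      by (simp add: g_def sum_divide_distrib[symmetric])
    ultimately show ?thesis
      unfolding cdf_def
      by (subst measure_distr) (auto intro!: arg_cong[where f = "measure _"])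
  qed
  ultimately show ?thesis by (simp add: m_def \<gamma>_def)
qed

text \<open>Tightness is read off from the normal limit: a level w is taken at which both normal
  tails are below \<epsilon> / 2.\<close>

lemma bounded_in_prob_centred_sum:
  assumes ab: "a > 0" "b > 0" and h: "tame h" and pos: "gig_cov (p, a, b) h h > 0"
  shows "bounded_in_prob (\<lambda>n. sample_law n p a b)
    (\<lambda>n x. (\<Sum>i<n. h (x i) - gig_E (p, a, b) h) / sqrt (real n))"
  unfolding bounded_in_prob_def
proof (intro allI impI)
  fix \<epsilon> :: real assume \<epsilon>: "\<epsilon> > 0"
  define s where "s = sqrt (gig_cov (p, a, b) h h)"
  have s: "s > 0" using pos by (simp add: s_def)
  define Y where "Y n x = (\<Sum>i<n. h (x i) - gig_E (p, a, b) h) / sqrt (real n)" for n :: nat and x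
  have Y[measurable]: "Y n \<in> borel_measurable (sample_law n p a b)" for n
    unfolding Y_def
    by (intro borel_measurable_divide borel_measurable_sum borel_measurable_diff
        borel_measurable_const measurable_sample_component tame_measurable h) auto
  have clt: "(\<lambda>n. \<P>(x in sample_law n p a b. Y n x / s \<le> w)) \<longlonglongrightarrow> Phi w" for w
    using gig_clt[OF ab tendsto_const h pos] by (simp add: Y_def s_def)
  have "((\<lambda>w. 1 - Phi w) \<longlongrightarrow> 1 - 1) at_top"
    unfolding Phi_def by (intro tendsto_intros std_normal.cdf_lim_at_top_prob)
  then have "\<forall>\<^sub>F w in at_top. 1 - Phi w < \<epsilon> / 2"
    by (rule order_tendstoD(2)) (use \<epsilon> in auto)
  moreover have "((\<lambda>w. Phi (- w)) \<longlongrightarrow> 0) at_top"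
    unfolding Phi_def by (rule filterlim_compose[OF std_normal.cdf_lim_at_bot filterlim_uminus_at_bot_at_top])
  then have "\<forall>\<^sub>F w in at_top. Phi (- w) < \<epsilon> / 2"
    by (rule order_tendstoD(2)) (use \<epsilon> in auto)
  ultimately have "\<forall>\<^sub>F w in at_top. 1 - Phi w < \<epsilon> / 2 \<and> Phi (- w) < \<epsilon> / 2"
    by eventually_elim auto
  then obtain w where w: "1 - Phi w < \<epsilon> / 2" "Phi (- w) < \<epsilon> / 2"
    by (auto simp: eventually_at_top_linorder)
  have "\<forall>\<^sub>F n in sequentially. \<P>(x in sample_law n p a b. Y n x / s \<le> w) > 1 - \<epsilon> / 2"
    by (rule order_tendstoD(1)[OF clt]) (use w in auto)
  moreover have "\<forall>\<^sub>F n in sequentially. \<P>(x in sample_law n p a b. Y n x / s \<le> - w) < \<epsilon> / 2"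
    by (rule order_tendstoD(2)[OF clt]) (use w in auto)
  ultimately have "\<forall>\<^sub>F n in sequentially. \<P>(x in sample_law n p a b. \<bar>Y n x\<bar> > s * w) \<le> \<epsilon>"
  proof eventually_elim
    case (elim n)
    interpret prob_space "sample_law n p a b" by (rule prob_space_sample_law[OF ab])
    let ?S = "space (sample_law n p a b)"
    have "prob {x \<in> ?S. \<bar>Y n x\<bar> > s * w} \<le> prob ((?S - {x \<in> ?S. Y n x / s \<le> w}) \<union> {x \<in> ?S. Y n x / s \<le> - w})"
      using s by (intro finite_measure_mono) (auto simp: abs_if field_simps split: if_splits)
    also have "\<dots> \<le> prob (?S - {x \<in> ?S. Y n x / s \<le> w}) + prob {x \<in> ?S. Y n x / s \<le> - w}"
      by (intro measure_Un_le) auto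
    also have "prob (?S - {x \<in> ?S. Y n x / s \<le> w}) = 1 - prob {x \<in> ?S. Y n x / s \<le> w}"
      by (intro prob_compl) auto
    finally show ?case using elim by linarith
  qed
  then show "\<exists>C. \<forall>\<^sub>F n in sequentially. \<P>(x in sample_law n p a b.
      \<bar>(\<Sum>i<n. h (x i) - gig_E (p, a, b) h) / sqrt (real n)\<bar> > C) \<le> \<epsilon>"
    unfolding Y_def by blast
qed

section \<open>Tilting in p and contiguity of the local alternatives\<close>

lemma gig_exponential_tilt:
  assumes ab: "a > 0" "b > 0"
  shows "gig (p + s) a b = density (gig p a b)
    (\<lambda>x. ennreal (gig_norm (p, a, b) / gig_norm (p + s, a, b) * exp (s * ln x)))"
proof -
  let ?G = "\<lambda>q. gig_norm (q, a, b)"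
  have G: "?G q > 0" for q using ab by (intro gig_norm_pos) (simp add: gig_params_iff)
  have "tame (\<lambda>x. (q, a, b) \<bullet> gig_stat x)" for q by simp
  note [measurable] = tame_measurable[OF this]
  have m1: "(\<lambda>x. ennreal (exp ((q, a, b) \<bullet> gig_stat x) / x / ?G q)) \<in> borel_measurable half_line" for q
    by (intro measurable_restrict_space1) measurable
  have m2: "(\<lambda>x. ennreal (?G p / ?G (p + s) * exp (s * ln x))) \<in> borel_measurable half_line"
    by (intro measurable_restrict_space1) measurable
  have tilt: "exp ((p + s, a, b) \<bullet> gig_stat x) = exp (s * ln x) * exp ((p, a, b) \<bullet> gig_stat x)" for x
    by (simp add: inner_gig_stat algebra_simps flip: exp_add)
  show ?thesis
    unfolding gig_eq_density[OF ab]
    using G[of p] G[of "p + s"]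
    by (subst density_density_eq[OF m1 m2],
        intro density_cong[OF m1 borel_measurable_times_ennreal[OF m1 m2]] AE_I2)
       (simp add: space_restrict_space ennreal_mult'[symmetric] tilt)
qed

text \<open>The squared tilt is again a tilt, by 2 s, so the second moment is a ratio of normalising
  constants at p, p + s and p + 2 s.\<close>

lemma gig_E_tilt_squared:
  assumes ab: "a > 0" "b > 0"
  shows "gig_E (p, a, b) (\<lambda>x. (gig_norm (p, a, b) / gig_norm (p + s, a, b) * exp (s * ln x))\<^sup>2)
    = gig_norm (p + 2 * s, a, b) * gig_norm (p, a, b) / (gig_norm (p + s, a, b))\<^sup>2"
proof -
  let ?c = "gig_norm (p, a, b) / gig_norm (p + s, a, b)"
  have G: "gig_norm (p, a, b) > 0" using ab by (intro gig_norm_pos) (simp add: gig_params_iff)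
  have "gig_E (p, a, b) (\<lambda>x. (?c * exp (s * ln x))\<^sup>2) = gig_E (p, a, b) (\<lambda>x. ?c\<^sup>2 * exp ((2 * s) * ln x))"
    by (simp add: power_mult_distrib power_divide exp_double[symmetric] mult.assoc)
  also have "\<dots> = ?c\<^sup>2 * (gig_int (\<lambda>x. exp ((2 * s) * ln x)) (p, a, b) / gig_norm (p, a, b))"
    by (subst gig_E_cmult) (simp add: gig_E_def)
  also have "gig_int (\<lambda>x. exp ((2 * s) * ln x)) (p, a, b) = gig_norm ((p, a, b) + (2 * s, 0, 0))"
    by (rule gig_int_shift) (simp add: inner_gig_stat)
  finally show ?thesis using G by (simp add: power2_eq_square field_simps)
qed

text \<open>The left-hand side is the second moment of the likelihood ratio of one observation; for \<open>n\<close>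
  observations it is raised to the power \<open>n\<close>, which stays bounded when \<open>s n = O(1 / \<surd>n)\<close>.\<close>

lemma gig_tilt_second_moment:
  assumes ab: "a > 0" "b > 0" and s: "s \<longlonglongrightarrow> (0 :: real)"
  obtains c where "c \<ge> 0" "\<forall>\<^sub>F n in sequentially.
    gig_norm (p + 2 * s n, a, b) * gig_norm (p, a, b) / (gig_norm (p + s n, a, b))\<^sup>2 \<le> 1 + c * (s n)\<^sup>2"
proof -
  let ?\<theta> = "(p, a, b)"
  have \<theta>: "(q, a, b) \<in> gig_params" for q using ab by (simp add: gig_params_iff)
  obtain \<rho> C where \<rho>: "\<rho> > 0" "C \<ge> 0" and R: "\<And>h. norm h \<le> \<rho> \<Longrightarrow>
      \<bar>gig_norm (?\<theta> + h) - gig_norm ?\<theta> - gig_int (\<lambda>x. 1 * (h \<bullet> gig_stat x)) ?\<theta>\<bar> \<le> C * (norm h)\<^sup>2"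
    using gig_int_remainder[OF tame_const[of 1] \<theta>[of p]] by metis
  define G where "G t = gig_norm (p + t, a, b)" for t
  define D where "D = gig_int ln ?\<theta>"
  have G0: "G t > 0" for t unfolding G_def by (intro gig_norm_pos \<theta>)
  have R': "\<bar>G t - G 0 - t * D\<bar> \<le> C * t\<^sup>2" if "\<bar>t\<bar> \<le> \<rho>" for t
    using R[of "(t, 0, 0)"] that by (simp add: G_def D_def inner_gig_stat gig_int_cmult norm_Pair)
  \<comment> \<open>The coefficient 6 collects 4 from the remainder at 2 t and 2 from the remainder
    at t, both multiplied by G 0; the last term bounds the cross term t * D * r1 using |t| \<le>
    \<rho>.\<close>
  define c1 where "c1 = 6 * C * G 0 + 2 * \<rho> * \<bar>D\<bar> * C"
  have c1: "c1 \<ge> 0" unfolding c1_def using \<rho> G0[of 0] by simp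
  \<comment> \<open>In G (2 t) * G 0 - G t ^ 2 the constant and linear terms cancel, which is why
    the excess is quadratic. The bound \<rho> / 2 on t keeps 2 t within the range of the Taylor
    estimate.\<close>
  have num: "G (2 * t) * G 0 - (G t)\<^sup>2 \<le> c1 * t\<^sup>2" if t: "\<bar>t\<bar> \<le> \<rho> / 2" for t
  proof -
    define r1 where "r1 = G t - G 0 - t * D"
    define r2 where "r2 = G (2 * t) - G 0 - 2 * t * D"
    have r1: "\<bar>r1\<bar> \<le> C * t\<^sup>2" unfolding r1_def using t \<rho> by (intro R') auto
    have r2: "\<bar>r2\<bar> \<le> 4 * (C * t\<^sup>2)" unfolding r2_def using R'[of "2 * t"] t \<rho> by (simp add: power2_eq_square mult_ac)
    have "G (2 * t) * G 0 - (G t)\<^sup>2 = r2 * G 0 - 2 * G 0 * r1 - 2 * (t * D) * r1 - (t * D)\<^sup>2 - r1\<^sup>2"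
      unfolding r1_def r2_def by (simp add: power2_eq_square algebra_simps)
    also have "\<dots> \<le> r2 * G 0 - 2 * G 0 * r1 - 2 * (t * D) * r1" by simp
    also have "\<dots> \<le> 4 * (C * t\<^sup>2) * G 0 + 2 * G 0 * (C * t\<^sup>2) + 2 * (\<rho> * \<bar>D\<bar>) * (C * t\<^sup>2)"
    proof -
      have 1: "r2 * G 0 \<le> 4 * (C * t\<^sup>2) * G 0"
        using r2 G0[of 0] by (intro mult_right_mono) auto
      have 2: "- (2 * G 0 * r1) \<le> 2 * G 0 * (C * t\<^sup>2)"
        using mult_left_mono[of "- r1" "C * t\<^sup>2" "2 * G 0"] r1 G0[of 0] by simp
      have "\<bar>2 * (t * D) * r1\<bar> = 2 * (\<bar>t\<bar> * \<bar>D\<bar>) * \<bar>r1\<bar>" by (simp add: abs_mult)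
      also have "\<dots> \<le> 2 * (\<rho> * \<bar>D\<bar>) * (C * t\<^sup>2)"
        using t r1 \<rho> by (intro mult_mono) auto
      finally have 3: "- (2 * (t * D) * r1) \<le> 2 * (\<rho> * \<bar>D\<bar>) * (C * t\<^sup>2)" by linarith
      from 1 2 3 show ?thesis by linarith
    qed
    also have "\<dots> = c1 * t\<^sup>2" by (simp add: c1_def algebra_simps)
    finally show ?thesis .
  qed
  have Gs: "(\<lambda>n. (G (s n))\<^sup>2) \<longlonglongrightarrow> (G 0)\<^sup>2"
  proof -
    have "(\<lambda>n. p + s n) \<longlonglongrightarrow> p" using tendsto_add[OF tendsto_const[of p] s] by simp
    then have "(\<lambda>n. gig_norm (p + s n, a, b)) \<longlonglongrightarrow> gig_norm (p, a, b)"
      using has_derivative_continuous[OF gig_int_has_derivative[OF tame_const[of 1] \<theta>[of p]]]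
      by (intro isCont_tendsto_compose[of "(p, a, b)" gig_norm]) (auto intro!: tendsto_intros)
    then have "(\<lambda>n. gig_norm (p + s n, a, b)) \<longlonglongrightarrow> gig_norm (p + 0, a, b)" by simp
    then show ?thesis unfolding G_def by (intro tendsto_intros)
  qed
  \<comment> \<open>Eventually the squared normaliser in the denominator exceeds half of its
    limit.\<close>
  define c where "c = c1 / ((G 0)\<^sup>2 / 2)"
  have "\<forall>\<^sub>F n in sequentially. (G (s n))\<^sup>2 > (G 0)\<^sup>2 / 2"
    using G0[of 0] by (intro order_tendstoD(1)[OF Gs]) simp
  moreover have "\<forall>\<^sub>F n in sequentially. \<bar>s n\<bar> < \<rho> / 2"
    using tendsto_rabs[OF s] \<rho> by (intro order_tendstoD(2)) auto
  ultimately have "\<forall>\<^sub>F n in sequentially. G (2 * s n) * G 0 / (G (s n))\<^sup>2 \<le> 1 + c * (s n)\<^sup>2"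
  proof eventually_elim
    case (elim n)
    have pos: "(G 0)\<^sup>2 / 2 > 0" using G0[of 0] by simp
    have "G (2 * s n) * G 0 \<le> (G (s n))\<^sup>2 + c1 * (s n)\<^sup>2" using num[of "s n"] elim by simp
    then have "G (2 * s n) * G 0 / (G (s n))\<^sup>2 \<le> ((G (s n))\<^sup>2 + c1 * (s n)\<^sup>2) / (G (s n))\<^sup>2"
      by (intro divide_right_mono) auto
    also have "\<dots> = 1 + c1 * (s n)\<^sup>2 / (G (s n))\<^sup>2"
      using G0[of "s n"] by (simp add: add_divide_distrib)
    also have "\<dots> \<le> 1 + c1 * (s n)\<^sup>2 / ((G 0)\<^sup>2 / 2)"
      using elim c1 pos by (intro add_left_mono divide_left_mono mult_nonneg_nonneg mult_pos_pos) auto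
    finally show ?case unfolding c_def by (simp only: times_divide_eq_left)
  qed
  then show ?thesis using that[of c] c1 by (simp add: G_def c_def)
qed

text \<open>One observation has second moment at most 1 + c s^2 \<le> exp (c s^2). With s = \<tau> /
  sqrt n the n-th power is at most exp (c \<tau>^2), and a convergent \<tau> is bounded.\<close>

lemma sample_law_contiguous:
  assumes ab: "a > 0" "b > 0" and \<tau>: "\<tau> \<longlonglongrightarrow> \<tau>1"
    and A: "\<And>n. A n \<in> sets (positive_samples n)"
    and lim: "(\<lambda>n. measure (sample_law n p a b) (A n)) \<longlonglongrightarrow> 0"
  shows "(\<lambda>n. measure (sample_law n (p + \<tau> n / sqrt (real n)) a b) (A n)) \<longlonglongrightarrow> 0"
proof -
  define s where "s n = \<tau> n / sqrt (real n)" for n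
  have s: "s \<longlonglongrightarrow> 0"
    unfolding s_def
    by (intro tendsto_divide_0[OF \<tau>] filterlim_at_top_imp_at_infinity
        filterlim_compose[OF sqrt_at_top filterlim_real_sequentially])
  define f where "f n x = gig_norm (p, a, b) / gig_norm (p + s n, a, b) * exp (s n * ln x)" for n x
  have gig_s: "gig (p + s n) a b = density (gig p a b) (\<lambda>x. ennreal (f n x))" for n
    unfolding f_def by (rule gig_exponential_tilt[OF ab])
  have f0: "f n x \<ge> 0" for n x
    unfolding f_def using gig_norm_pos[of "(p, a, b)"] gig_norm_pos[of "(p + s n, a, b)"] ab
    by (simp add: gig_params_iff)
  have tf: "tame (f n)" for n unfolding f_def[abs_def] by (intro tame_cmult tame_exp_mult_ln)
  obtain T where T: "\<And>n. \<bar>\<tau> n\<bar> \<le> T"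
    using convergentI[OF \<tau>, THEN convergent_imp_Bseq] unfolding Bseq_def by auto
  obtain c where c: "c \<ge> 0" "\<forall>\<^sub>F n in sequentially.
    gig_norm (p + 2 * s n, a, b) * gig_norm (p, a, b) / (gig_norm (p + s n, a, b))\<^sup>2 \<le> 1 + c * (s n)\<^sup>2"
    using gig_tilt_second_moment[OF ab s] by blast
  have "(\<lambda>n. measure (\<Pi>\<^sub>M i\<in>{..<n}. density (gig p a b) (\<lambda>x. ennreal (f n x))) (A n)) \<longlonglongrightarrow> 0"
  proof (rule contiguity_if_bounded_second_moment)
    show "\<forall>\<^sub>F n in sequentially. (\<integral>x. (f n x)\<^sup>2 \<partial>gig p a b) ^ n \<le> exp (c * T\<^sup>2)"
      using c(2) eventually_ge_at_top[of 1]
    proof eventually_elim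
      case (elim n)
      have "(\<integral>x. (f n x)\<^sup>2 \<partial>gig p a b) \<le> 1 + c * (s n)\<^sup>2"
        using elim(1) gig_E_tilt_squared[OF ab, of p "s n"]
        unfolding integral_gig[OF ab tame_power[OF tf]] by (simp only: f_def)
      also have "\<dots> \<le> exp (c * (s n)\<^sup>2)" by (rule exp_ge_add_one_self)
      finally have "(\<integral>x. (f n x)\<^sup>2 \<partial>gig p a b) ^ n \<le> exp (c * (s n)\<^sup>2) ^ n"
        by (intro power_mono) auto
      \<comment> \<open>Here n \<ge> 1 is used: n cancels against the square of sqrt n in
        \<open>s n\<close>.\<close>
      also have "\<dots> = exp (c * (\<tau> n)\<^sup>2)"
        using elim(2) by (simp add: s_def power_divide flip: exp_of_nat_mult)
      also have "\<dots> \<le> exp (c * T\<^sup>2)"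
        using c(1) T[of n] by (auto intro!: mult_left_mono simp: abs_le_square_iff[symmetric])
      finally show ?case .
    qed
    show "A n \<in> sets (\<Pi>\<^sub>M i\<in>{..<n}. gig p a b)" for n
      using A[of n] sets_sample_law[of n p a b] by (simp add: sample_law_def)
    show "(\<lambda>n. measure (\<Pi>\<^sub>M i\<in>{..<n}. gig p a b) (A n)) \<longlonglongrightarrow> 0"
      using lim by (simp add: sample_law_def)
    show "prob_space (density (gig p a b) (\<lambda>x. ennreal (f n x)))" for n
      unfolding gig_s[symmetric] by (rule prob_space_gig[OF ab])
  qed (use tf f0 in \<open>auto intro!: prob_space_gig integrable_gig ab tame_measurable_gig tame_power\<close>)
  then show ?thesis by (simp add: sample_law_def gig_s[symmetric] s_def)
qed

section \<open>Plugging in the estimators\<close>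

lemma tendsto_bounded_mult_null:
  fixes s k :: "nat \<Rightarrow> real"
  assumes s: "\<And>n. \<bar>s n\<bar> \<le> C" and k: "k \<longlonglongrightarrow> 0"
  shows "(\<lambda>n. s n * k n) \<longlonglongrightarrow> 0"
proof (rule Lim_null_comparison)
  show "\<forall>\<^sub>F n in sequentially. norm (s n * k n) \<le> C * \<bar>k n\<bar>"
    using s by (auto simp: abs_mult intro!: always_eventually mult_right_mono)
  show "(\<lambda>n. C * \<bar>k n\<bar>) \<longlonglongrightarrow> 0"
    using tendsto_mult[OF tendsto_const[of C] tendsto_rabs[OF k]] by simp
qed

text \<open>A delta method along bounded directions that may vary with n: the remainder is o(1 /
  sqrt n) uniformly over the ball of directions. It serves both for the estimation errors and for
  the drift in p.\<close>

lemma tendsto_scaled_increment: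
  fixes f :: "'a::real_normed_vector \<Rightarrow> real" and w :: "nat \<Rightarrow> 'a"
  assumes f: "(f has_derivative D) (at x)" and w: "\<And>n. norm (w n) \<le> C"
  shows "(\<lambda>n. sqrt (real n) * (f (x + w n /\<^sub>R sqrt (real n)) - f x) - D (w n)) \<longlonglongrightarrow> 0"
proof (rule tendstoI)
  fix e :: real assume e: "e > 0"
  have C: "C \<ge> 0" using order_trans[OF norm_ge_zero w] .
  have lin: "linear D" using has_derivative_linear[OF f] .
  \<comment> \<open>Dividing by C + 1 gives e' * C < e also when C = 0.\<close>
  define e' where "e' = e / (C + 1)"
  have e': "e' > 0" "e' * C < e" using e C by (auto simp: e'_def field_simps)
  obtain d where d: "d > 0" "\<And>y. norm (y - x) < d \<Longrightarrow> norm (f y - f x - D (y - x)) \<le> e' * norm (y - x)"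
    using f e'(1) unfolding has_derivative_at_alt by blast
  \<comment> \<open>Beyond C / d the increments have norm below d; the bound 1 keeps the scaling
    factor positive.\<close>
  have "\<forall>\<^sub>F n in sequentially. sqrt (real n) > max 1 (C / d)"
    using filterlim_compose[OF sqrt_at_top filterlim_real_sequentially]
    by (simp only: filterlim_at_top_dense)
  then show "\<forall>\<^sub>F n in sequentially.
      dist (sqrt (real n) * (f (x + w n /\<^sub>R sqrt (real n)) - f x) - D (w n)) 0 < e"
  proof eventually_elim
    case (elim n)
    define r where "r = sqrt (real n)"
    have r: "r > 1" "C < d * r" using elim d(1) by (auto simp: r_def field_simps)
    define h where "h = w n /\<^sub>R r"
    have rh: "norm h = norm (w n) / r" using r by (simp add: h_def inverse_eq_divide)
    also have "\<dots> < d" using w[of n] r by (simp add: divide_less_eq)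
    finally have "norm h < d" .
    then have "norm (f (x + h) - f x - D h) \<le> e' * norm h" using d(2)[of "x + h"] by simp
    then have "r * norm (f (x + h) - f x - D h) \<le> r * (e' * norm h)"
      using r by (intro mult_left_mono) auto
    also have "r * (e' * norm h) = e' * norm (w n)" using r by (simp add: rh)
    also have "\<dots> \<le> e' * C" using e'(1) w[of n] by (intro mult_left_mono) auto
    also have "\<dots> < e" by (rule e')
    also have "r * norm (f (x + h) - f x - D h) = \<bar>r * (f (x + h) - f x) - r * D h\<bar>"
      using r by (simp add: abs_mult flip: right_diff_distrib)
    also have "r * D h = D (w n)"
      using r linear_scale[OF lin, of "1 / r" "w n"] by (simp add: h_def inverse_eq_divide)
    finally show ?case by (simp add: h_def r_def)
  qed
qed

section \<open>The error caused by estimating the nuisance parameters\<close>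

definition eff_info :: "real \<times> real \<times> real \<Rightarrow> real" where
  "eff_info \<theta> = gig_cov \<theta> (eff_score \<theta>) ln"

lemma eff_info_pos: "\<theta> \<in> gig_params \<Longrightarrow> eff_info \<theta> > 0"
  by (simp add: eff_info_def eff_score_cov_pos)

lemma eff_coeff_continuous_on:
  "continuous_on gig_params eff_coeff_a" "continuous_on gig_params eff_coeff_b"
  unfolding eff_coeff_a_def[abs_def] eff_coeff_b_def[abs_def] eff_det_def
  by (intro continuous_intros gig_cov_continuous_on tame_ln tame_stat_a tame_stat_b ballI;
      drule eff_det_pos; simp add: eff_det_def)+

lemma eff_info_continuous_on: "continuous_on gig_params eff_info"
proof -
  have "continuous_on gig_params (\<lambda>\<theta>. gig_cov \<theta> ln ln - eff_coeff_a \<theta> * gig_cov \<theta> stat_a ln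
      - eff_coeff_b \<theta> * gig_cov \<theta> stat_b ln)"
    by (intro continuous_intros gig_cov_continuous_on eff_coeff_continuous_on) auto
  then show ?thesis
    by (rule continuous_on_eq) (simp add: eff_info_def eff_score_cov)
qed

text \<open>The difference between the studentized efficient central sequence with estimated and with true
  nuisance parameters, as a function of the centred sums \<open>sp, sa, sb\<close> of the sufficient statistics
  and of the rescaled estimation errors \<open>u, v\<close>.\<close>

definition plug_in_error ::
  "real \<times> real \<times> real \<Rightarrow> nat \<Rightarrow> real \<times> real \<times> real \<times> real \<times> real \<Rightarrow> real" where
  "plug_in_error \<theta> n = (\<lambda>(sp, sa, sb, u, v).
     let \<theta>' = \<theta> + (0, u, v) /\<^sub>R sqrt (real n);
         d = (\<lambda>f. sqrt (real n) * (gig_E \<theta>' f - gig_E \<theta> f))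
     in (sp - d ln - eff_coeff_a \<theta>' * (sa - d stat_a) - eff_coeff_b \<theta>' * (sb - d stat_b)) / sqrt (eff_info \<theta>')
        - (sp - eff_coeff_a \<theta> * sa - eff_coeff_b \<theta> * sb) / sqrt (eff_info \<theta>))"

text \<open>Three effects are separated: bounded sums times vanishing changes of the coefficients,
  Taylor remainders of the recentred means, and terms linear in u and v. The linear terms need not
  be small by themselves; their coefficients tend to covariances of the efficient score with
  \<open>stat_a\<close> and \<open>stat_b\<close>, which are zero.\<close>

lemma plug_in_error_tendsto_0:
  assumes \<theta>: "\<theta> \<in> gig_params"
    and s: "\<And>n. s n \<in> {(sp, sa, sb, u, v). \<bar>sp\<bar> \<le> C \<and> \<bar>sa\<bar> \<le> C \<and> \<bar>sb\<bar> \<le> C \<and> \<bar>u\<bar> \<le> C \<and> \<bar>v\<bar> \<le> C}"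
  shows "(\<lambda>n. plug_in_error \<theta> n (s n)) \<longlonglongrightarrow> 0"
proof -
  define sp where "sp n = fst (s n)" for n
  define sa where "sa n = fst (snd (s n))" for n
  define sb where "sb n = fst (snd (snd (s n)))" for n
  define u where "u n = fst (snd (snd (snd (s n))))" for n
  define v where "v n = snd (snd (snd (snd (s n))))" for n
  have s_eq: "s n = (sp n, sa n, sb n, u n, v n)" for n
    by (simp add: sp_def sa_def sb_def u_def v_def)
  have bd: "\<bar>sp n\<bar> \<le> C" "\<bar>sa n\<bar> \<le> C" "\<bar>sb n\<bar> \<le> C" "\<bar>u n\<bar> \<le> C" "\<bar>v n\<bar> \<le> C" for n
    using s[of n] by (auto simp: s_eq)
  define w :: "nat \<Rightarrow> real \<times> real \<times> real" where "w n = (0, u n, v n)" for n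
  have w: "norm (w n) \<le> 2 * C" for n
  proof -
    have "norm (w n) \<le> norm (0 :: real) + norm (u n, v n)" unfolding w_def by (rule norm_Pair_le)
    also have "\<dots> \<le> norm (u n) + norm (v n)" using norm_Pair_le[of "u n" "v n"] by simp
    finally show ?thesis using bd[of n] by simp
  qed
  define \<theta>' where "\<theta>' n = \<theta> + w n /\<^sub>R sqrt (real n)" for n
  have inv: "(\<lambda>n. 1 / sqrt (real n)) \<longlonglongrightarrow> 0"
    by (intro tendsto_divide_0[OF tendsto_const] filterlim_at_top_imp_at_infinity
        filterlim_compose[OF sqrt_at_top filterlim_real_sequentially])
  have \<theta>': "\<theta>' \<longlonglongrightarrow> \<theta>"
  proof -
    have "(\<lambda>n. norm (w n) * (1 / sqrt (real n))) \<longlonglongrightarrow> 0"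
      using w by (intro tendsto_bounded_mult_null[OF _ inv, of _ "2 * C"]) simp
    moreover have "norm (w n) * (1 / sqrt (real n)) = norm (w n /\<^sub>R sqrt (real n))" for n
      by (simp add: inverse_eq_divide)
    ultimately have "(\<lambda>n. w n /\<^sub>R sqrt (real n)) \<longlonglongrightarrow> 0"
      by (simp only: tendsto_norm_zero_cancel)
    then have "(\<lambda>n. \<theta> + w n /\<^sub>R sqrt (real n)) \<longlonglongrightarrow> \<theta> + 0"
      by (rule tendsto_add[OF tendsto_const])
    then show ?thesis by (simp add: \<theta>'_def[abs_def])
  qed
  have lim: "(\<lambda>n. F (\<theta>' n)) \<longlonglongrightarrow> F \<theta>" if "continuous_on gig_params F" for F :: "_ \<Rightarrow> real"
    using that \<theta>' \<theta> open_gig_params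
    by (metis continuous_on_eq_continuous_at isCont_tendsto_compose)
  \<comment> \<open>The Taylor remainder left after the linear effect of the rescaled errors on the
    mean of f is removed.\<close>
  define r where "r f n = sqrt (real n) * (gig_E (\<theta>' n) f - gig_E \<theta> f)
      - (u n * gig_cov \<theta> f stat_a + v n * gig_cov \<theta> f stat_b)" for f n
  have r: "r f \<longlonglongrightarrow> 0" if f: "tame f" for f
  proof -
    have "gig_cov \<theta> f (\<lambda>x. w n \<bullet> gig_stat x) = u n * gig_cov \<theta> f stat_a + v n * gig_cov \<theta> f stat_b" for n
    proof -
      have "(\<lambda>x. w n \<bullet> gig_stat x) = (\<lambda>x. u n * stat_a x - (- v n) * stat_b x)"
        by (simp add: w_def inner_gig_stat_Pair)
      then show ?thesis
        using f \<theta> gig_cov_diff_right[of "\<lambda>x. u n * stat_a x" "\<lambda>x. (- v n) * stat_b x" f \<theta>]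
        by (simp only: tame_cmult tame_stat_a tame_stat_b gig_cov_cmult_right)
    qed
    then show ?thesis
      using tendsto_scaled_increment[OF gig_E_has_derivative[OF f \<theta>] w] by (simp add: r_def[abs_def] \<theta>'_def)
  qed
  let ?q = "\<lambda>n. 1 / sqrt (eff_info (\<theta>' n))"
  let ?ca = "\<lambda>n. eff_coeff_a (\<theta>' n)" and ?cb = "\<lambda>n. eff_coeff_b (\<theta>' n)"
  have q: "?q \<longlonglongrightarrow> 1 / sqrt (eff_info \<theta>)"
    using eff_info_pos[OF \<theta>] by (intro tendsto_intros lim eff_info_continuous_on) auto
  note ca = lim[OF eff_coeff_continuous_on(1)] and cb = lim[OF eff_coeff_continuous_on(2)]
  \<comment> \<open>Regression coefficients at the estimated parameter meet covariances at the true
    one, so this is not zero for finite n; it tends to the covariance of the efficient score with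
    g.\<close>
  let ?k = "\<lambda>g n. gig_cov \<theta> ln g - ?ca n * gig_cov \<theta> stat_a g - ?cb n * gig_cov \<theta> stat_b g"
  have k: "(\<lambda>n. ?k g n * ?q n) \<longlonglongrightarrow> 0" if "tame g" "gig_cov \<theta> (eff_score \<theta>) g = 0" for g
  proof -
    have "(\<lambda>n. ?k g n * ?q n) \<longlonglongrightarrow> gig_cov \<theta> (eff_score \<theta>) g * (1 / sqrt (eff_info \<theta>))"
      unfolding eff_score_cov[OF that(1) \<theta>] by (intro tendsto_intros q ca cb)
    then show ?thesis by (simp add: that)
  qed
  \<comment> \<open>An exact identity, obtained by writing each recentring as its linear part plus
    \<open>r\<close> and collecting the coefficients of the five bounded quantities.\<close>
  have "plug_in_error \<theta> n (s n) =
      sp n * (?q n - 1 / sqrt (eff_info \<theta>))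
      - sa n * (?ca n * ?q n - eff_coeff_a \<theta> * (1 / sqrt (eff_info \<theta>)))
      - sb n * (?cb n * ?q n - eff_coeff_b \<theta> * (1 / sqrt (eff_info \<theta>)))
      - (r ln n - ?ca n * r stat_a n - ?cb n * r stat_b n) * ?q n
      - u n * (?k stat_a n * ?q n) - v n * (?k stat_b n * ?q n)" for n
    unfolding plug_in_error_def s_eq prod.case Let_def r_def \<theta>'_def[of n, unfolded w_def, symmetric]
    by (simp add: algebra_simps diff_divide_distrib add_divide_distrib)
  moreover have "(\<lambda>n. sp n * (?q n - 1 / sqrt (eff_info \<theta>))
      - sa n * (?ca n * ?q n - eff_coeff_a \<theta> * (1 / sqrt (eff_info \<theta>)))
      - sb n * (?cb n * ?q n - eff_coeff_b \<theta> * (1 / sqrt (eff_info \<theta>)))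
      - (r ln n - ?ca n * r stat_a n - ?cb n * r stat_b n) * ?q n
      - u n * (?k stat_a n * ?q n) - v n * (?k stat_b n * ?q n)) \<longlonglongrightarrow>
      0 - 0 - 0 - (0 - eff_coeff_a \<theta> * 0 - eff_coeff_b \<theta> * 0) * (1 / sqrt (eff_info \<theta>)) - 0 - 0"
    by (intro tendsto_diff tendsto_bounded_mult_null[OF bd(1)] tendsto_bounded_mult_null[OF bd(2)]
        tendsto_bounded_mult_null[OF bd(3)] tendsto_bounded_mult_null[OF bd(4)]
        tendsto_bounded_mult_null[OF bd(5)] tendsto_mult q ca cb r tame_ln tame_stat_a tame_stat_b
        k eff_score_orthogonal \<theta> LIM_zero)
  ultimately show ?thesis by simp
qed

lemma sum_recentre:
  fixes f :: "nat \<Rightarrow> real"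
  shows "(\<Sum>i<n. f i - m') / sqrt (real n) = (\<Sum>i<n. f i - m) / sqrt (real n) - sqrt (real n) * (m' - m)"
proof (cases "n = 0")
  case False
  have "(\<Sum>i<n. f i - m') = (\<Sum>i<n. f i - m) - real n * (m' - m)"
    by (simp add: sum_subtractf algebra_simps)
  also have "\<dots> / sqrt (real n) = (\<Sum>i<n. f i - m) / sqrt (real n) - (real n / sqrt (real n)) * (m' - m)"
    by (simp add: diff_divide_distrib)
  finally show ?thesis by (simp add: real_div_sqrt)
qed simp

text \<open>The sample enters only through sums of the three statistics, so changing the nuisance
  parameters merely recentres these sums and changes the coefficients. With n \<ge> 1 the rescaled
  errors recover the estimates exactly.\<close>

lemma Q_eff_eq_plug_in_error:
  fixes n :: nat and x :: "nat \<Rightarrow> real" and p a b A B :: real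
  assumes ab: "a > 0" "b > 0" and AB: "A > 0" "B > 0" and n: "n \<ge> 1"
  defines "S \<equiv> \<lambda>f. (\<Sum>i<n. f (x i) - gig_E (p, a, b) f) / sqrt (real n)"
  shows "Q_eff n x p A B - Q_eff n x p a b
    = plug_in_error (p, a, b) n (S ln, S stat_a, S stat_b, sqrt (real n) * (A - a), sqrt (real n) * (B - b))"
proof -
  have \<theta>': "(p, a, b) + (0, sqrt (real n) * (A - a), sqrt (real n) * (B - b)) /\<^sub>R sqrt (real n) = (p, A, B)"
    using n by (simp add: field_simps)
  have S': "(\<Sum>i<n. f (x i) - gig_E (p, A, B) f) / sqrt (real n)
      = S f - sqrt (real n) * (gig_E (p, A, B) f - gig_E (p, a, b) f)" for f
    unfolding S_def by (rule sum_recentre)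
  show ?thesis
    unfolding plug_in_error_def prod.case Let_def \<theta>' Q_eff_def Gamma_eff_eq[OF ab] Gamma_eff_eq[OF AB]
      Delta_eff_eq[OF ab] Delta_eff_eq[OF AB] Delta_eq[OF AB] S' eff_info_def
    unfolding Delta_eq[OF ab] S_def by simp
qed

section \<open>Measurability of the test statistic\<close>

lemma measurable_gig_params_comp:
  assumes F: "continuous_on gig_params (F :: _ \<Rightarrow> real)"
    and [measurable]: "A \<in> borel_measurable M" "B \<in> borel_measurable M"
    and pos: "\<And>x. x \<in> space M \<Longrightarrow> A x > 0 \<and> B x > 0"
  shows "(\<lambda>x. F (p, A x, B x)) \<in> borel_measurable M"
proof -
  have "(\<lambda>x. (p, A x, B x)) \<in> M \<rightarrow>\<^sub>M restrict_space borel gig_params"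
    using pos by (intro measurable_restrict_space2) (auto simp: gig_params_iff borel_prod[symmetric])
  moreover have "F \<in> borel_measurable (restrict_space borel gig_params)"
    by (rule borel_measurable_continuous_on_restrict[OF F])
  ultimately show ?thesis by (rule measurable_compose)
qed

text \<open>Its definition passes through \<open>deriv\<close>; at positive nuisance parameters it
  agrees with a formula in functions that are continuous on \<open>gig_params\<close>, and
  measurability is proved for that formula.\<close>

lemma measurable_Q_eff:
  assumes A: "A \<in> borel_measurable (positive_samples n)" and B: "B \<in> borel_measurable (positive_samples n)"
    and pos: "\<And>x. x \<in> space (positive_samples n) \<Longrightarrow> A x > 0 \<and> B x > 0"
  shows "(\<lambda>x. Q_eff n x p (A x) (B x)) \<in> borel_measurable (positive_samples n)"
proof -
  note F = measurable_gig_params_comp[OF _ A B pos]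
  have comp: "(\<lambda>x. f (x i)) \<in> borel_measurable (positive_samples n)" if "f \<in> borel_measurable borel" "i < n" for f :: "real \<Rightarrow> real" and i
    using measurable_sample_component[OF that, of p 1 1]
    by (simp only: measurable_cong_sets[OF sets_sample_law refl])
  have S: "(\<lambda>x. (\<Sum>i<n. f (x i) - gig_E (p, A x, B x) f) / sqrt (real n)) \<in> borel_measurable (positive_samples n)"
    if f: "tame f" for f
    by (intro borel_measurable_divide borel_measurable_sum borel_measurable_diff borel_measurable_const
        F[OF gig_E_continuous_on[OF f]] comp tame_measurable f) auto
  have "(\<lambda>x. ((\<Sum>i<n. ln (x i) - gig_E (p, A x, B x) ln) / sqrt (real n)
      - eff_coeff_a (p, A x, B x) * ((\<Sum>i<n. stat_a (x i) - gig_E (p, A x, B x) stat_a) / sqrt (real n))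
      - eff_coeff_b (p, A x, B x) * ((\<Sum>i<n. stat_b (x i) - gig_E (p, A x, B x) stat_b) / sqrt (real n)))
      / sqrt (eff_info (p, A x, B x))) \<in> borel_measurable (positive_samples n)"
    by (intro borel_measurable_divide borel_measurable_diff borel_measurable_times S
        borel_measurable_sqrt[THEN measurable_compose_rev] tame_ln tame_stat_a tame_stat_b
        F[OF eff_coeff_continuous_on(1)] F[OF eff_coeff_continuous_on(2)] F[OF eff_info_continuous_on])
  moreover have "Q_eff n x p (A x) (B x) = ((\<Sum>i<n. ln (x i) - gig_E (p, A x, B x) ln) / sqrt (real n)
      - eff_coeff_a (p, A x, B x) * ((\<Sum>i<n. stat_a (x i) - gig_E (p, A x, B x) stat_a) / sqrt (real n))
      - eff_coeff_b (p, A x, B x) * ((\<Sum>i<n. stat_b (x i) - gig_E (p, A x, B x) stat_b) / sqrt (real n)))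
      / sqrt (eff_info (p, A x, B x))" if "x \<in> space (positive_samples n)" for x
    using pos[OF that] by (simp add: Q_eff_def Gamma_eff_eq Delta_eff_eq Delta_eq eff_info_def)
  ultimately show ?thesis by (subst measurable_cong) auto
qed

lemma measurable_Q_eff_estimated:
  assumes "positive_estimators ahat" "positive_estimators bhat" "n \<ge> 1"
  shows "(\<lambda>x. Q_eff n x p (ahat n x) (bhat n x)) \<in> borel_measurable (positive_samples n)"
  using assms by (intro measurable_Q_eff) (auto simp: positive_estimators_def)

text \<open>Outside five exceptional events the three sums and the two errors lie in a fixed box, on
  which the plug-in error is eventually at most e. The sums are tight by the central limit theorem,
  the errors by assumption.\<close>

lemma plug_in_negligible:
  assumes ab: "a > 0" "b > 0" and est: "positive_estimators ahat" "positive_estimators bhat"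
    and ahat: "bounded_in_prob (\<lambda>n. sample_law n p a b) (\<lambda>n x. sqrt (real n) * (ahat n x - a))"
    and bhat: "bounded_in_prob (\<lambda>n. sample_law n p a b) (\<lambda>n x. sqrt (real n) * (bhat n x - b))"
    and e: "e > 0"
  shows "(\<lambda>n. \<P>(x in sample_law n p a b.
    \<bar>Q_eff n x p (ahat n x) (bhat n x) - Q_eff n x p a b\<bar> > e)) \<longlonglongrightarrow> 0"
proof (rule tendstoI)
  fix \<epsilon> :: real assume \<epsilon>: "\<epsilon> > 0"
  let ?P = "\<lambda>n. sample_law n p a b"
  have \<theta>: "(p, a, b) \<in> gig_params" using ab by (simp add: gig_params_iff)
  define Y where "Y f n x = (\<Sum>i<n. f (x i) - gig_E (p, a, b) f) / sqrt (real n)"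
    for f :: "real \<Rightarrow> real" and n :: nat and x
  define U where "U n x = sqrt (real n) * (ahat n x - a)" for n x
  define V where "V n x = sqrt (real n) * (bhat n x - b)" for n x
  have pos: "gig_cov (p, a, b) f f > 0" if "f \<in> {ln, stat_a, stat_b}" for f
    using gig_cov_pos[OF \<theta>, of "(1, 0, 0)"] gig_cov_pos[OF \<theta>, of "(0, 1, 0)"]
      gig_cov_pos[OF \<theta>, of "(0, 0, 1)"] that
    by (auto simp: inner_gig_stat_Pair zero_prod_def)
  \<comment> \<open>Five events of probability at most \<epsilon> / 6 leave a strict inequality for
    the total.\<close>
  have bp: "\<exists>C. \<forall>\<^sub>F n in sequentially. \<P>(x in ?P n. \<bar>Z n x\<bar> > C) \<le> \<epsilon> / 6"
    if "bounded_in_prob ?P Z" for Z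
    using that[unfolded bounded_in_prob_def, rule_format, of "\<epsilon> / 6"] \<epsilon> by auto
  have bY: "bounded_in_prob ?P (Y f)" if "f \<in> {ln, stat_a, stat_b}" for f
    using bounded_in_prob_centred_sum[OF ab _ pos[OF that]] that by (auto simp: Y_def[abs_def])
  obtain C1 where C1: "\<forall>\<^sub>F n in sequentially. \<P>(x in ?P n. \<bar>Y ln n x\<bar> > C1) \<le> \<epsilon> / 6"
    using bp[OF bY[of ln]] by auto
  obtain C2 where C2: "\<forall>\<^sub>F n in sequentially. \<P>(x in ?P n. \<bar>Y stat_a n x\<bar> > C2) \<le> \<epsilon> / 6"
    using bp[OF bY[of stat_a]] by auto
  obtain C3 where C3: "\<forall>\<^sub>F n in sequentially. \<P>(x in ?P n. \<bar>Y stat_b n x\<bar> > C3) \<le> \<epsilon> / 6"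
    using bp[OF bY[of stat_b]] by auto
  obtain C4 where C4: "\<forall>\<^sub>F n in sequentially. \<P>(x in ?P n. \<bar>U n x\<bar> > C4) \<le> \<epsilon> / 6"
    using bp[OF ahat] by (auto simp: U_def)
  obtain C5 where C5: "\<forall>\<^sub>F n in sequentially. \<P>(x in ?P n. \<bar>V n x\<bar> > C5) \<le> \<epsilon> / 6"
    using bp[OF bhat] by (auto simp: V_def)
  define C where "C = Max {C1, C2, C3, C4, C5}"
  have C: "C1 \<le> C" "C2 \<le> C" "C3 \<le> C" "C4 \<le> C" "C5 \<le> C" unfolding C_def by (auto intro: Max_ge)
  let ?K = "{(sp, sa, sb, u, v). \<bar>sp\<bar> \<le> C \<and> \<bar>sa\<bar> \<le> C \<and> \<bar>sb\<bar> \<le> C \<and> \<bar>u\<bar> \<le> C \<and> \<bar>v\<bar> \<le> C}"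
  have "\<forall>\<^sub>F n in sequentially. \<forall>s\<in>?K. \<bar>plug_in_error (p, a, b) n s\<bar> \<le> e"
    by (rule eventually_uniformly_small[OF plug_in_error_tendsto_0[OF \<theta>] e])
  with C1 C2 C3 C4 C5 eventually_ge_at_top[of 1]
  show "\<forall>\<^sub>F n in sequentially. dist (\<P>(x in ?P n.
      \<bar>Q_eff n x p (ahat n x) (bhat n x) - Q_eff n x p a b\<bar> > e)) 0 < \<epsilon>"
  proof eventually_elim
    case (elim n)
    interpret prob_space "?P n" by (rule prob_space_sample_law[OF ab])
    have mY: "Y f n \<in> borel_measurable (?P n)" if "tame f" for f
      unfolding Y_def
      by (intro borel_measurable_divide borel_measurable_sum borel_measurable_diff
          borel_measurable_const measurable_sample_component tame_measurable that) auto
    have est': "ahat n \<in> borel_measurable (?P n)" "bhat n \<in> borel_measurable (?P n)"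
      using est elim(6) unfolding measurable_cong_sets[OF sets_sample_law refl]
      by (auto simp: positive_estimators_def)
    have [measurable]: "U n \<in> borel_measurable (?P n)" "V n \<in> borel_measurable (?P n)"
      unfolding U_def V_def using est' by measurable
    note [measurable] = mY[OF tame_ln] mY[OF tame_stat_a] mY[OF tame_stat_b]
    let ?S = "space (?P n)"
    have "prob {x \<in> ?S. \<bar>Q_eff n x p (ahat n x) (bhat n x) - Q_eff n x p a b\<bar> > e}
        \<le> prob ({x \<in> ?S. \<bar>Y ln n x\<bar> > C1} \<union> ({x \<in> ?S. \<bar>Y stat_a n x\<bar> > C2} \<union> ({x \<in> ?S. \<bar>Y stat_b n x\<bar> > C3}
          \<union> ({x \<in> ?S. \<bar>U n x\<bar> > C4} \<union> {x \<in> ?S. \<bar>V n x\<bar> > C5}))))"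
    proof (rule finite_measure_mono)
      show "{x \<in> ?S. \<bar>Q_eff n x p (ahat n x) (bhat n x) - Q_eff n x p a b\<bar> > e}
        \<subseteq> {x \<in> ?S. \<bar>Y ln n x\<bar> > C1} \<union> ({x \<in> ?S. \<bar>Y stat_a n x\<bar> > C2} \<union> ({x \<in> ?S. \<bar>Y stat_b n x\<bar> > C3}
          \<union> ({x \<in> ?S. \<bar>U n x\<bar> > C4} \<union> {x \<in> ?S. \<bar>V n x\<bar> > C5})))"
      proof (rule subsetI, rule ccontr)
        fix x assume x: "x \<in> {x \<in> ?S. \<bar>Q_eff n x p (ahat n x) (bhat n x) - Q_eff n x p a b\<bar> > e}"
          and "x \<notin> {x \<in> ?S. \<bar>Y ln n x\<bar> > C1} \<union> ({x \<in> ?S. \<bar>Y stat_a n x\<bar> > C2} \<union> ({x \<in> ?S. \<bar>Y stat_b n x\<bar> > C3}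
          \<union> ({x \<in> ?S. \<bar>U n x\<bar> > C4} \<union> {x \<in> ?S. \<bar>V n x\<bar> > C5})))"
        then have "(Y ln n x, Y stat_a n x, Y stat_b n x, U n x, V n x) \<in> ?K"
          using C by auto
        then have "\<bar>plug_in_error (p, a, b) n (Y ln n x, Y stat_a n x, Y stat_b n x, U n x, V n x)\<bar> \<le> e"
          using elim(7) by blast
        moreover have "ahat n x > 0" "bhat n x > 0"
          using est elim(6) x by (auto simp: positive_estimators_def space_sample_law)
        ultimately have "\<bar>Q_eff n x p (ahat n x) (bhat n x) - Q_eff n x p a b\<bar> \<le> e"
          using Q_eff_eq_plug_in_error[OF ab _ _ elim(6), of "ahat n x" "bhat n x" x p]
          by (simp add: Y_def U_def V_def)
        then show False using x by simp
      qed
    qed auto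
    also have "\<dots> \<le> prob {x \<in> ?S. \<bar>Y ln n x\<bar> > C1} + (prob {x \<in> ?S. \<bar>Y stat_a n x\<bar> > C2}
        + (prob {x \<in> ?S. \<bar>Y stat_b n x\<bar> > C3} + (prob {x \<in> ?S. \<bar>U n x\<bar> > C4} + prob {x \<in> ?S. \<bar>V n x\<bar> > C5})))"
      by (intro order_trans[OF measure_Un_le] add_left_mono sets.Un) auto
    also have "\<dots> < \<epsilon>" using elim \<epsilon> by linarith
    finally show ?case by simp
  qed
qed

text \<open>At the true nuisance parameters the statistic splits into a sum centred under the
  alternative, which is asymptotically standard normal, and a deterministic drift. Replacing them by
  the estimates is negligible at \<open>p0\<close>, and by contiguity also here.\<close>

lemma Q_eff_cdf_local_alternatives:
  assumes A: "assumption_A p0 ahat bhat" and ab: "a > 0" "b > 0" and \<tau>: "\<tau> \<longlonglongrightarrow> \<tau>1"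
  defines "P \<equiv> \<lambda>n. sample_law n (p0 + \<tau> n / sqrt (real n)) a b"
    and "Q \<equiv> \<lambda>n x. Q_eff n x p0 (ahat n x) (bhat n x)"
  shows "(\<lambda>n. \<P>(x in P n. Q n x \<le> z)) \<longlonglongrightarrow> Phi (z - \<tau>1 * sqrt (Gamma_eff p0 a b))"
    and "(\<lambda>n. \<P>(x in P n. Q n x < z)) \<longlonglongrightarrow> Phi (z - \<tau>1 * sqrt (Gamma_eff p0 a b))"
proof -
  have \<theta>: "(p0, a, b) \<in> gig_params" using ab by (simp add: gig_params_iff)
  have est: "positive_estimators ahat" "positive_estimators bhat"
    and root_n: "bounded_in_prob (\<lambda>n. sample_law n p0 a b) (\<lambda>n x. sqrt (real n) * (ahat n x - a))"
      "bounded_in_prob (\<lambda>n. sample_law n p0 a b) (\<lambda>n x. sqrt (real n) * (bhat n x - b))"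
    using A ab by (auto simp: assumption_A_def)
  define h where "h = eff_score (p0, a, b)"
  have h: "tame h" by (simp add: h_def)
  define \<gamma> where "\<gamma> = Gamma_eff p0 a b"
  have \<gamma>: "\<gamma> > 0" "gig_cov (p0, a, b) h h = \<gamma>" "gig_cov (p0, a, b) h ln = \<gamma>"
    using Gamma_eff_pos[OF ab] eff_score_cov_ln[OF \<theta>] Gamma_eff_eq[OF ab]
    by (simp_all add: \<gamma>_def h_def)
  define p where "p n = p0 + \<tau> n / sqrt (real n)" for n
  have p: "p \<longlonglongrightarrow> p0"
  proof -
    have "(\<lambda>n. p0 + \<tau> n / sqrt (real n)) \<longlonglongrightarrow> p0 + 0"
      by (intro tendsto_add tendsto_const tendsto_divide_0[OF \<tau>] filterlim_at_top_imp_at_infinity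
          filterlim_compose[OF sqrt_at_top filterlim_real_sequentially])
    then show ?thesis by (simp add: p_def[abs_def])
  qed
  define W where "W n x = (\<Sum>i<n. h (x i) - gig_E (p n, a, b) h) / sqrt (real n) / sqrt \<gamma>" for n :: nat and x
  \<comment> \<open>The drift: sqrt n times the change of the mean of the fixed score at
    \<open>p0\<close> between null and alternative, divided by its standard deviation.\<close>
  define \<kappa> where "\<kappa> n = sqrt (real n) * (gig_E (p n, a, b) h - gig_E (p0, a, b) h) / sqrt \<gamma>" for n
  define d where "d = \<tau>1 * sqrt \<gamma>"
  have \<kappa>: "\<kappa> \<longlonglongrightarrow> d"
  proof -
    obtain T where T: "\<And>n. norm (\<tau> n) \<le> T"
      using convergentI[OF \<tau>, THEN convergent_imp_Bseq] unfolding Bseq_def by auto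
    \<comment> \<open>The derivative of the mean in p is the covariance with ln, here equal to
      \<gamma>. After division by sqrt \<gamma> the drift tends to \<tau>1 * sqrt \<gamma>.\<close>
    have "((\<lambda>t. gig_E (t, a, b) h) has_derivative (*) \<gamma>) (at p0)"
      using gig_E_DERIV(1)[OF h ab, of p0] by (simp add: has_field_derivative_def \<gamma>)
    from tendsto_scaled_increment[OF this T]
    have "(\<lambda>n. sqrt (real n) * (gig_E (p n, a, b) h - gig_E (p0, a, b) h) - \<gamma> * \<tau> n) \<longlonglongrightarrow> 0"
      by (simp add: p_def divide_inverse mult.commute)
    from tendsto_add[OF this tendsto_mult[OF tendsto_const[of \<gamma>] \<tau>]]
    have "(\<lambda>n. sqrt (real n) * (gig_E (p n, a, b) h - gig_E (p0, a, b) h)) \<longlonglongrightarrow> \<gamma> * \<tau>1" by simp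
    then have "\<kappa> \<longlonglongrightarrow> \<gamma> * \<tau>1 / sqrt \<gamma>"
      unfolding \<kappa>_def[abs_def] using \<gamma>(1) by (intro tendsto_divide tendsto_const) auto
    also have "\<gamma> * \<tau>1 / sqrt \<gamma> = d"
      unfolding d_def times_divide_eq_left[of \<gamma> "sqrt \<gamma>" \<tau>1, symmetric]
      using \<gamma>(1) by (simp only: real_div_sqrt less_imp_le mult.commute)
    finally show ?thesis .
  qed
  have Q0: "Q_eff n x p0 a b = W n x + \<kappa> n" for n x
    unfolding Q_eff_def Delta_eff_eq_sum[OF ab] W_def \<kappa>_def h_def[symmetric] \<gamma>_def[symmetric]
      sum_recentre[where m' = "gig_E (p0, a, b) h" and m = "gig_E (p n, a, b) h"]
    by (simp add: diff_divide_distrib right_diff_distrib)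
  have P_eq: "P n = sample_law n (p n) a b" for n by (simp add: P_def p_def)
  have lim: "(\<lambda>n. \<P>(x in P n. W n x \<le> w)) \<longlonglongrightarrow> Phi w" for w
    unfolding P_eq W_def using gig_clt[OF ab p h, of w] \<gamma> by simp
  have mW: "W n \<in> borel_measurable (P n)" for n
    unfolding W_def P_eq
    by (intro borel_measurable_divide borel_measurable_sum borel_measurable_diff
        borel_measurable_const measurable_sample_component tame_measurable h) auto
  have mQ: "Q n \<in> borel_measurable (sample_law n q a b)" if "n \<ge> 1" for n q
    using measurable_Q_eff_estimated[OF est that] unfolding Q_def
    by (simp only: measurable_cong_sets[OF sets_sample_law refl])
  have mQ0: "(\<lambda>x. Q_eff n x p0 a b) \<in> borel_measurable (positive_samples n)" for n
    using ab by (intro measurable_Q_eff) auto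
  have diff: "(\<lambda>n. \<P>(x in P n. \<bar>Q n x - W n x - d\<bar> > e)) \<longlonglongrightarrow> 0" if e: "e > 0" for e
  proof -
    \<comment> \<open>The contiguity lemma asks for measurable sets at every n, whereas the
      estimators are constrained only from n = 1 on; the empty set fills the gap at n = 0.\<close>
    define B where "B n = (if n \<ge> 1 then {x \<in> space (positive_samples n). \<bar>Q n x - Q_eff n x p0 a b\<bar> > e / 2} else {})" for n
    have B: "B n \<in> sets (positive_samples n)" for n
    proof (cases "n \<ge> 1")
      case True
      note [measurable] = measurable_Q_eff_estimated[OF est True, of p0] mQ0[of n]
      show ?thesis using True unfolding B_def Q_def by simp
    qed (simp add: B_def)
    have "(\<lambda>n. measure (sample_law n p0 a b) (B n)) \<longlonglongrightarrow> 0"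
    proof (rule Lim_transform_eventually)
      show "(\<lambda>n. \<P>(x in sample_law n p0 a b. \<bar>Q n x - Q_eff n x p0 a b\<bar> > e / 2)) \<longlonglongrightarrow> 0"
        unfolding Q_def using e by (intro plug_in_negligible[OF ab est root_n]) simp
      show "\<forall>\<^sub>F n in sequentially. \<P>(x in sample_law n p0 a b. \<bar>Q n x - Q_eff n x p0 a b\<bar> > e / 2)
          = measure (sample_law n p0 a b) (B n)"
        using eventually_ge_at_top[of 1] by eventually_elim (simp add: B_def space_sample_law)
    qed
    then have "(\<lambda>n. measure (P n) (B n)) \<longlonglongrightarrow> 0"
      unfolding P_def by (intro sample_law_contiguous[OF ab \<tau> B])
    then show ?thesis
    proof (rule Lim_null_comparison[rotated])
      have "\<forall>\<^sub>F n in sequentially. dist (\<kappa> n) d < e / 2"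
        using e by (intro tendstoD[OF \<kappa>]) simp
      then show "\<forall>\<^sub>F n in sequentially. norm (\<P>(x in P n. \<bar>Q n x - W n x - d\<bar> > e)) \<le> measure (P n) (B n)"
        using eventually_ge_at_top[of 1]
      proof eventually_elim
        case (elim n)
        interpret prob_space "P n" unfolding P_eq by (rule prob_space_sample_law[OF ab])
        have "prob {x \<in> space (P n). \<bar>Q n x - W n x - d\<bar> > e} \<le> prob (B n)"
        proof (rule finite_measure_mono)
          show "B n \<in> sets (P n)" using B by (simp add: P_eq sets_sample_law)
          show "{x \<in> space (P n). \<bar>Q n x - W n x - d\<bar> > e} \<subseteq> B n"
          proof
            fix x assume x: "x \<in> {x \<in> space (P n). \<bar>Q n x - W n x - d\<bar> > e}"
            have "\<bar>\<kappa> n - d\<bar> < e / 2" using elim(1) by (simp only: dist_real_def)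
            \<comment> \<open>The deviation e is split: half pays for the distance of
              \<open>\<kappa> n\<close> from its limit, half remains for the plug-in error.\<close>
            with x have "\<bar>Q n x - (W n x + \<kappa> n)\<bar> > e / 2" unfolding mem_Collect_eq by linarith
            then show "x \<in> B n"
              using x elim(2) by (simp add: B_def Q0 P_eq space_sample_law)
          qed
        qed
        then show ?case by simp
      qed
    qed
  qed
  have prob: "prob_space (P n)" for n unfolding P_eq by (rule prob_space_sample_law[OF ab])
  have mQ': "\<forall>\<^sub>F n in sequentially. Q n \<in> borel_measurable (P n)"
    using eventually_ge_at_top[of 1] by eventually_elim (simp add: P_eq mQ)
  show "(\<lambda>n. \<P>(x in P n. Q n x \<le> z)) \<longlonglongrightarrow> Phi (z - \<tau>1 * sqrt (Gamma_eff p0 a b))"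
    and "(\<lambda>n. \<P>(x in P n. Q n x < z)) \<longlonglongrightarrow> Phi (z - \<tau>1 * sqrt (Gamma_eff p0 a b))"
    using slutsky_cdf[OF prob mW mQ' lim isCont_Phi diff, of z] by (simp_all add: d_def \<gamma>_def)
qed

section \<open>Asymptotic power of the three tests\<close>

theorem mainTheorem3:
  fixes p0 \<alpha> a b \<tau>1 :: real
    and ahat bhat :: "nat \<Rightarrow> (nat \<Rightarrow> real) \<Rightarrow> real"
    and \<tau> :: "nat \<Rightarrow> real"
    and P :: "nat \<Rightarrow> (nat \<Rightarrow> real) measure"
    and Q :: "nat \<Rightarrow> (nat \<Rightarrow> real) \<Rightarrow> real"
  assumes "0 < \<alpha>" and "\<alpha> < 1"
    and "assumption_A p0 ahat bhat"
    and "a > 0" and "b > 0"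
    and "bounded (range \<tau>)" and "\<tau> \<longlonglongrightarrow> \<tau>1"
  defines "P \<equiv> \<lambda>n. sample_law n (p0 + \<tau> n / sqrt (real n)) a b"
    and "Q \<equiv> \<lambda>n x. Q_eff n x p0 (ahat n x) (bhat n x)"
  shows "((\<lambda>n. \<P>(x in P n. \<bar>Q n x\<bar> > upper_quantile (\<alpha> / 2)))
            \<longlonglongrightarrow> 1 - Phi (upper_quantile (\<alpha> / 2) - \<tau>1 * sqrt (Gamma_eff p0 a b))
                  + Phi (- upper_quantile (\<alpha> / 2) - \<tau>1 * sqrt (Gamma_eff p0 a b)))
       \<and> ((\<lambda>n. \<P>(x in P n. Q n x > upper_quantile \<alpha>))
            \<longlonglongrightarrow> 1 - Phi (upper_quantile \<alpha> - \<tau>1 * sqrt (Gamma_eff p0 a b)))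
       \<and> ((\<lambda>n. \<P>(x in P n. Q n x < - upper_quantile \<alpha>))
            \<longlonglongrightarrow> Phi (- upper_quantile \<alpha> - \<tau>1 * sqrt (Gamma_eff p0 a b)))"
proof -
  define d where "d = \<tau>1 * sqrt (Gamma_eff p0 a b)"
  \<comment> \<open>Both forms are used: the weak inequality gives the upper tail by complement, the
    strict one is the lower rejection region itself.\<close>
  have le: "(\<lambda>n. \<P>(x in P n. Q n x \<le> z)) \<longlonglongrightarrow> Phi (z - d)"
    and less: "(\<lambda>n. \<P>(x in P n. Q n x < z)) \<longlonglongrightarrow> Phi (z - d)" for z
    unfolding P_def Q_def d_def using assms(3-5,7) by (rule Q_eff_cdf_local_alternatives)+
  have prob: "prob_space (P n)" for n
    unfolding P_def using assms(4,5) by (rule prob_space_sample_law)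
  have mQ: "Q n \<in> borel_measurable (P n)" if "n \<ge> 1" for n
    unfolding P_def Q_def measurable_cong_sets[OF sets_sample_law refl]
    using assms(3) that by (intro measurable_Q_eff_estimated) (auto simp: assumption_A_def)
  have compl: "\<P>(x in P n. Q n x > z) = 1 - \<P>(x in P n. Q n x \<le> z)" if "n \<ge> 1" for n z
  proof -
    interpret prob_space "P n" by (rule prob)
    note [measurable] = mQ[OF that]
    show ?thesis
      using prob_neg[of "\<lambda>x. Q n x \<le> z"] by (simp add: not_le)
  qed
  have greater: "(\<lambda>n. \<P>(x in P n. Q n x > z)) \<longlonglongrightarrow> 1 - Phi (z - d)" for z
  proof (rule Lim_transform_eventually[OF tendsto_diff[OF tendsto_const le]])
    show "\<forall>\<^sub>F n in sequentially. 1 - \<P>(x in P n. Q n x \<le> z) = \<P>(x in P n. Q n x > z)"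
      using eventually_ge_at_top[of 1] by eventually_elim (simp add: compl)
  qed
  let ?z = "upper_quantile (\<alpha> / 2)"
  \<comment> \<open>From \<alpha> < 1 one gets \<alpha> / 2 < 1 / 2, so the critical value is
    positive and the two-sided rejection region is a disjoint union of two tails.\<close>
  have z: "?z > 0" using assms(1,2) by (intro upper_quantile_pos) auto
  have two_sided: "\<P>(x in P n. \<bar>Q n x\<bar> > ?z) = \<P>(x in P n. Q n x > ?z) + \<P>(x in P n. Q n x < - ?z)"
    if "n \<ge> 1" for n
  proof -
    interpret prob_space "P n" by (rule prob)
    note [measurable] = mQ[OF that]
    have "{x \<in> space (P n). \<bar>Q n x\<bar> > ?z} = {x \<in> space (P n). Q n x > ?z} \<union> {x \<in> space (P n). Q n x < - ?z}"
      using z by auto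
    then show ?thesis
      using z by (simp add: finite_measure_Union[symmetric] disjoint_iff)
  qed
  have "(\<lambda>n. \<P>(x in P n. \<bar>Q n x\<bar> > ?z)) \<longlonglongrightarrow> 1 - Phi (?z - d) + Phi (- ?z - d)"
  proof (rule Lim_transform_eventually[OF tendsto_add[OF greater less]])
    show "\<forall>\<^sub>F n in sequentially. \<P>(x in P n. Q n x > ?z) + \<P>(x in P n. Q n x < - ?z) = \<P>(x in P n. \<bar>Q n x\<bar> > ?z)"
      using eventually_ge_at_top[of 1] by eventually_elim (simp add: two_sided)
  qed
  with greater less show ?thesis by (simp add: d_def)
qed

end
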